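(* Let $\xi \in \mathcal{D}_1$ and let $N$ be an arbitrary non-negative integer. Let $\mu$ and $\nu$ be complex numbers satisfying $|\Re\mu | < N + \frac{1}{2}$ and $\Re\nu > N - \frac{1}{2}$. Then $$e^{-\pi i\mu }Q_\nu ^\mu (\cosh \xi ) = \frac{\sqrt{\frac{\pi}{2\sinh \xi } }\, e^{ - \left(\nu+\frac{1}{2}\right) \xi}}{\Gamma (\nu - \mu + 1)} \left( \sum_{n = 0}^{N - 1} a_n (\mu )\Gamma \left( \nu - n + \tfrac{1}{2} \right)\left( \frac{e^\xi }{\sinh \xi } \right)^n + R_N^{(Q)} (\xi ,\mu ,\nu ) \right) ,$$ where the remainder term satisfies the estimate $$\left| R_N^{(Q)} (\xi ,\mu ,\nu ) \right| \le \left| \frac{\cos (\pi \mu ) }{\cos (\pi \Re\mu ) }\right|\left| a_N (\Re\mu ) \right| \Gamma \left( \Re\nu - N + \tfrac{1}{2} \right) \left| \frac{e^\xi }{\sinh \xi } \right|^N.$$ If $2\Re\mu $ is an odd integer, then the limiting value has to be taken in this bound. The square root is positive for positive real $\xi$ and is defined by continuity elsewhere. In addition, $R_N^{(Q)} (\xi ,\mu ,\nu )$ does not exceed the corresponding first neglected term $a_N(\mu)\Gamma(\nu-N+\frac12)\left(\frac{e^\xi}{\sinh\xi}\right)^N$ in absolute value and has the same sign, provided that $\xi$ is positive, $\mu$ and $\nu$ are real, $|\mu| <N + \frac{1}{2}$ and $\nu > N - \frac{1}{2}$.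
   Context: $\mathcal{D}_1=\{\xi\in\mathbb{C} : \Re \xi>0,\ |\Im \xi |<\pi\}$; $\cosh$ maps $\mathcal{D}_1$ biholomorphically onto $\mathbb{C}\setminus(-\infty,1]$. The associated Legendre function of the second kind is defined, for $z\in\mathbb{C}\setminus(-\infty,1]$ and $\nu+\mu\notin\mathbb{Z}_{<0}$, by $$e^{-\pi i\mu }Q_\nu ^\mu (z) = \frac{\pi ^{1/2} \Gamma (\nu +\mu + 1)(z^2 - 1)^{\mu /2} }{2^{\nu + 1} z^{\nu +\mu + 1}}\mathbf{F}\left(\tfrac{\nu+\mu+2}{2},\tfrac{\nu+\mu+1}{2};\nu+\tfrac32;\tfrac{1}{z^2}\right),$$ with powers positive-based for $z>1$ and continued by analyticity, where $\mathbf{F}(a,b;c;w)$ is the regularised hypergeometric function, $\mathbf{F}(a,b;c;w)=\sum_{n\ge 0}\frac{(a)_n(b)_n}{\Gamma(c+n)\,n!}w^n$ for $|w|<1$, continued analytically to $w\in\mathbb{C}\setminus[1,+\infty)$. $a_n (\mu ) = \frac{(4\mu ^2 - 1^2 )(4\mu ^2 - 3^2 ) \cdots (4\mu ^2 - (2n - 1)^2 )}{8^n n!}=\frac{(\frac12-\mu)_n(\frac12+\mu)_n}{(-2)^n n!}$, with $(\cdot)_n$ the Pochhammer symbol. "Limiting value" means that $|a_N(\Re\mu)|/|\cos(\pi\Re\mu)|$ is replaced by $\lim_{x\to\Re\mu}|a_N(x)|/|\cos(\pi x)|$. *)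

theory Defs
  imports "HOL-Complex_Analysis.Complex_Analysis"
begin

definition D1 :: "complex set" where
  "D1 = {\<xi>. Re \<xi> > 0 \<and> \<bar>Im \<xi>\<bar> < pi}"

text \<open>
  The analytic continuation is unique because the slit plane is connected; the values on the
  cut \<open>[1, \<infinity>)\<close> are unspecified. The factor \<open>rGamma\<close> is the entire function \<open>1/\<Gamma>\<close>, so the
  series is meaningful for every \<open>c\<close>.
\<close>
definition hyp2F1_reg :: "complex \<Rightarrow> complex \<Rightarrow> complex \<Rightarrow> complex \<Rightarrow> complex" where
  "hyp2F1_reg a b c = (SOME f. f holomorphic_on (UNIV - complex_of_real ` {1..}) \<and>
     (\<forall>w. norm w < 1 \<longrightarrow>
        f w = (\<Sum>n. pochhammer a n * pochhammer b n * rGamma (c + of_nat n) / fact n * w ^ n)))"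

text \<open>
  Only used for \<open>z \<in> \<complex> - (-\<infinity>, 1]\<close> and \<open>\<nu> + \<mu>\<close> not a negative integer. On that domain
  \<open>(z - 1)\<^bsup>\<mu>/2\<^esup> (z + 1)\<^bsup>\<mu>/2\<^esup>\<close> with principal powers is the analytic continuation of
  \<open>(z\<^sup>2 - 1)\<^bsup>\<mu>/2\<^esup>\<close> from \<open>z > 1\<close>; the principal power of \<open>z\<^sup>2 - 1\<close> itself would be wrong
  for \<open>Re z \<le> 0\<close>.
\<close>
definition legendre_Q :: "complex \<Rightarrow> complex \<Rightarrow> complex \<Rightarrow> complex" where
  "legendre_Q \<nu> \<mu> z = exp (of_real pi * \<i> * \<mu>) *
     (of_real (sqrt pi) * Gamma (\<nu> + \<mu> + 1) * ((z - 1) powr (\<mu> / 2) * (z + 1) powr (\<mu> / 2)) /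
        (2 powr (\<nu> + 1) * z powr (\<nu> + \<mu> + 1)) *
      hyp2F1_reg ((\<nu> + \<mu> + 2) / 2) ((\<nu> + \<mu> + 1) / 2) (\<nu> + 3 / 2) (1 / z\<^sup>2))"

definition a_coeff :: "nat \<Rightarrow> 'a :: field_char_0 \<Rightarrow> 'a" where
  "a_coeff n \<mu> = (\<Prod>k=1..n. 4 * \<mu>\<^sup>2 - (2 * of_nat k - 1)\<^sup>2) / (8 ^ n * fact n)"

lemma a_coeff_pochhammer:
  "a_coeff n \<mu> = pochhammer (1/2 - \<mu>) n * pochhammer (1/2 + \<mu>) n / ((-2) ^ n * fact n)"
proof (induction n)
  case (Suc n)
  have "a_coeff (Suc n) \<mu> = a_coeff n \<mu> * ((4 * \<mu>\<^sup>2 - (2 * of_nat n + 1)\<^sup>2) / (8 * of_nat (Suc n)))"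
    by (simp add: a_coeff_def algebra_simps)
  also have "(4 * \<mu>\<^sup>2 - (2 * of_nat n + 1)\<^sup>2) / (8 * of_nat (Suc n)) =
      (1/2 - \<mu> + of_nat n) * (1/2 + \<mu> + of_nat n) / ((-2) * of_nat (Suc n))"
    by (simp add: divide_simps del: of_nat_Suc) (simp add: algebra_simps power2_eq_square)
  finally show ?case
    by (simp add: Suc.IH pochhammer_Suc mult_ac del: of_nat_Suc)
qed (simp add: a_coeff_def)

lemma legendre_power_branch:
  "(\<lambda>z. (z - 1) powr (\<mu> / 2) * (z + 1) powr (\<mu> / 2)) holomorphic_on
     (UNIV - complex_of_real ` {..1})"
  "x > 1 \<Longrightarrow> (complex_of_real x - 1) powr (\<mu> / 2) * (complex_of_real x + 1) powr (\<mu> / 2) =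
     complex_of_real (x\<^sup>2 - 1) powr (\<mu> / 2)"
proof -
  have *: "z \<in> complex_of_real ` {..1}" if "z - 1 \<in> \<real>\<^sub>\<le>\<^sub>0 \<or> z + 1 \<in> \<real>\<^sub>\<le>\<^sub>0" for z
    using that by (intro image_eqI[of _ _ "Re z"])
      (auto simp: complex_nonpos_Reals_iff complex_eq_iff)
  show "(\<lambda>z. (z - 1) powr (\<mu> / 2) * (z + 1) powr (\<mu> / 2)) holomorphic_on
     (UNIV - complex_of_real ` {..1})"
    by (intro holomorphic_intros) (use * in auto)
  assume x: "x > 1"
  have "(complex_of_real (x - 1) * complex_of_real (x + 1)) powr (\<mu> / 2) =
        complex_of_real (x - 1) powr (\<mu> / 2) * complex_of_real (x + 1) powr (\<mu> / 2)"
    using x by (intro powr_times_real) auto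
  then show "(complex_of_real x - 1) powr (\<mu> / 2) * (complex_of_real x + 1) powr (\<mu> / 2) =
     complex_of_real (x\<^sup>2 - 1) powr (\<mu> / 2)"
    by (simp add: power2_eq_square algebra_simps)
qed

text \<open>
  The principal square root is the continuous branch that is positive for \<open>\<xi> > 0\<close>.
\<close>
lemma csqrt_sinh_branch:
  "continuous_on D1 (\<lambda>\<xi>. csqrt (of_real pi / (2 * sinh \<xi>)))"
  "x > 0 \<Longrightarrow> csqrt (of_real pi / (2 * sinh (of_real x))) = of_real (sqrt (pi / (2 * sinh x)))"
proof -
  have nz: "sinh \<xi> \<notin> \<real>\<^sub>\<le>\<^sub>0" if "\<xi> \<in> D1" for \<xi>
  proof
    have *: "Re \<xi> > 0" "\<bar>Im \<xi>\<bar> < pi" using that by (auto simp: D1_def)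
    have R: "Re (sinh \<xi>) = sinh (Re \<xi>) * cos (Im \<xi>)" and I: "Im (sinh \<xi>) = cosh (Re \<xi>) * sin (Im \<xi>)"
      by (simp_all add: sinh_field_def cosh_field_def Re_exp Im_exp field_simps)
    assume "sinh \<xi> \<in> \<real>\<^sub>\<le>\<^sub>0"
    then have "sin (Im \<xi>) = 0" and le: "sinh (Re \<xi>) * cos (Im \<xi>) \<le> 0"
      using R I by (auto simp: complex_nonpos_Reals_iff)
    then have "Im \<xi> = 0" using *(2) by (metis sin_eq_0_pi abs_less_iff minus_less_iff)
    then show False using le *(1) by (simp add: not_le)
  qed
  have "of_real pi / (2 * sinh \<xi>) \<notin> \<real>\<^sub>\<le>\<^sub>0" if "\<xi> \<in> D1" for \<xi>
  proof
    assume "of_real pi / (2 * sinh \<xi>) \<in> \<real>\<^sub>\<le>\<^sub>0"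
    then obtain r where r: "of_real pi / (2 * sinh \<xi>) = of_real r" "r \<le> 0"
      by (auto elim: nonpos_Reals_cases)
    have "sinh \<xi> \<noteq> 0" using nz[OF that] by auto
    then have "r \<noteq> 0" "sinh \<xi> = of_real (pi / (2 * r))" using r by (auto simp: field_simps)
    then show False using nz[OF that] r(2) by (simp only: nonpos_Reals_of_real_iff) (simp add: divide_nonneg_nonpos)
  qed
  moreover have "sinh \<xi> \<noteq> 0" if "\<xi> \<in> D1" for \<xi> using nz[OF that] by auto
  ultimately show "continuous_on D1 (\<lambda>\<xi>. csqrt (of_real pi / (2 * sinh \<xi>)))"
    by (intro continuous_on_compose2[OF continuous_on_csqrt] continuous_on_divide
        continuous_on_mult continuous_on_const continuous_on_sinh continuous_on_id) auto
  assume "x > 0"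
  have "of_real pi / (2 * sinh (of_real x)) = complex_of_real (pi / (2 * sinh x))"
    by (simp add: sinh_field_def exp_of_real flip: of_real_minus)
  then show "csqrt (of_real pi / (2 * sinh (of_real x))) = of_real (sqrt (pi / (2 * sinh x)))"
    using \<open>x > 0\<close> by (metis csqrt_of_real_nonneg Im_complex_of_real Re_complex_of_real
        divide_nonneg_pos mult_pos_pos pi_ge_zero sinh_real_pos_iff zero_less_numeral of_real_sqrt)
qed

end

theory Submission
  imports Defs
begin

text \<open>
  Put \<open>X = exp \<xi> / (2 sinh \<xi>)\<close>, so that \<open>Re X > 0\<close>. A quadratic transformation, obtained from the
  hypergeometric equation for large real \<open>\<xi>\<close> and continued analytically in \<open>\<xi>\<close>, expresses the Legendre
  function through \<open>F(a, b; c; 1 - X)\<close> with \<open>a = 1/2 - \<mu>\<close>, \<open>b = 1/2 + \<mu>\<close> and \<open>c = \<nu> + 3/2\<close>. By Euler's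
  formula the latter is a multiple of the integral of
  \<open>t\<^bsup>b - 1\<^esup> (1 - t)\<^bsup>c - a - b - 1\<^esup> (1 + p)\<^bsup>- a\<^esup>\<close> over \<open>(0, 1)\<close>, where \<open>p = X t / (1 - t)\<close>. The Taylor
  polynomial of \<open>(1 + p)\<^bsup>- a\<^esup>\<close> produces the asymptotic sum through Beta integrals. Its remainder is at most
  \<open>\<Gamma>(Re a + N) / (|\<Gamma>(a)| N!) |p|\<^sup>N\<close>, because \<open>|\<Gamma>(z) k\<^bsup>- z\<^esup>| \<le> \<Gamma>(Re z)\<close> for \<open>Re k \<ge> 1\<close>, and for real
  parameters it has the sign of the first neglected term. The integral needs \<open>Re b > 0\<close>, which costs
  nothing, since every quantity involved is even in \<open>\<mu>\<close>.
\<close>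

subsection \<open>Parametric integrals and analytic continuation\<close>

lemma norm_higher_deriv_le_half_ball:
  assumes hol: "h holomorphic_on ball z r" and bound: "\<And>x. x \<in> ball z r \<Longrightarrow> norm (h x) \<le> B"
    and y_in: "y \<in> ball z (r / 2)"
  shows "norm ((deriv ^^ n) h y) \<le> fact n * B / (r / 2) ^ n"
proof (rule Cauchy_inequality)
  have subset: "cball y (r / 2) \<subseteq> ball z r"
    using y_in by (auto simp: subset_iff) metric
  show "h holomorphic_on ball y (r / 2)" "continuous_on (cball y (r / 2)) h"
    using hol subset by (meson ball_subset_cball holomorphic_on_subset
        holomorphic_on_imp_continuous_on order_trans)+
  show "norm (h x) \<le> B" if "norm (y - x) = r / 2" for x
    using subset that by (intro bound) (auto simp: subset_iff dist_norm)
  show "r / 2 > 0" using y_in zero_le_dist[of z y] unfolding mem_ball by linarith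
qed

lemma norm_difference_quotient_error_le:
  fixes h :: "complex \<Rightarrow> complex"
  assumes hol: "h holomorphic_on ball z r"
    and bound: "\<And>y. y \<in> ball z r \<Longrightarrow> norm (h y) \<le> B"
    and w_near: "w \<in> ball z (r / 2)" "w \<noteq> z"
  shows "norm ((h w - h z) / (w - z) - deriv h z) \<le> 8 * B / r\<^sup>2 * norm (w - z)"
proof -
  have "r > 0" using w_near(1) zero_le_dist[of z w] unfolding mem_ball by linarith
  have "norm ((deriv ^^ 0) h w - (\<Sum>i\<le>1. (deriv ^^ i) h z * (w - z) ^ i / fact i))
      \<le> 8 * B / r\<^sup>2 * norm (w - z) ^ Suc 1 / fact 1"
  proof (rule complex_Taylor[where S = "ball z (r / 2)" and f = "\<lambda>i. (deriv ^^ i) h"])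
    fix i y assume y_in: "y \<in> ball z (r / 2)"
    then have "(deriv ^^ i) h holomorphic_on ball z r" "y \<in> ball z r"
      using hol \<open>r > 0\<close> by (auto intro: holomorphic_higher_deriv)
    then show "((deriv ^^ i) h has_field_derivative (deriv ^^ Suc i) h y) (at y within ball z (r / 2))"
      by (auto intro: has_field_derivative_at_within holomorphic_derivI)
    show "norm ((deriv ^^ Suc 1) h y) \<le> 8 * B / r\<^sup>2"
      using norm_higher_deriv_le_half_ball[OF hol bound y_in, of "Suc 1"] by (simp add: power2_eq_square)
  qed (use w_near \<open>r > 0\<close> in auto)
  moreover have "(deriv ^^ 0) h w - (\<Sum>i\<le>1. (deriv ^^ i) h z * (w - z) ^ i / fact i) =
      ((h w - h z) / (w - z) - deriv h z) * (w - z)"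
    using w_near(2) by (simp add: field_simps)
  ultimately have "norm ((h w - h z) / (w - z) - deriv h z) * norm (w - z)
      \<le> 8 * B / r\<^sup>2 * norm (w - z) * norm (w - z)"
    by (simp only: norm_mult) simp
  then show ?thesis
    by (rule mult_right_le_imp_le) (use w_near(2) in simp)
qed

lemma borel_measurable_deriv_param:
  fixes f :: "complex \<Rightarrow> 'a \<Rightarrow> complex"
  assumes "open S" "z \<in> S"
    and meas: "\<And>w. w \<in> S \<Longrightarrow> f w \<in> borel_measurable M"
    and hol: "\<And>x. x \<in> space M \<Longrightarrow> (\<lambda>w. f w x) holomorphic_on S"
  shows "(\<lambda>x. deriv (\<lambda>w. f w x) z) \<in> borel_measurable M"
proof -
  obtain r where cball_subset: "r > 0" "cball z r \<subseteq> S" using assms(1,2) by (auto simp: open_contains_cball)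
  define h where "h = (\<lambda>n. complex_of_real (r / real (Suc n)))"
  have shift_in: "h n \<noteq> 0" "z + h n \<in> S" for n
    using cball_subset
    by (auto simp: h_def dist_norm norm_divide divide_le_eq simp del: of_nat_Suc
        intro!: subsetD[OF cball_subset(2)])
  have "h \<longlonglongrightarrow> of_real 0"
    unfolding h_def by (intro tendsto_of_real LIMSEQ_Suc lim_const_over_n)
  then have "filterlim h (at 0) sequentially"
    using shift_in(1) by (simp add: filterlim_at)
  then have "(\<lambda>n. (f (z + h n) x - f z x) / h n) \<longlonglongrightarrow> deriv (\<lambda>w. f w x) z" if "x \<in> space M" for x
    by (rule filterlim_compose[OF holomorphic_derivI[OF hol[OF that] assms(1,2), of UNIV, unfolded DERIV_def]])
  then show ?thesis
    by (rule borel_measurable_LIMSEQ_metric[rotated])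
       (auto intro!: borel_measurable_divide borel_measurable_diff meas shift_in assms(2))
qed

lemma norm_difference_quotient_integral_error_le:
  fixes f :: "complex \<Rightarrow> 'a \<Rightarrow> complex"
  assumes int: "\<And>w. w \<in> ball z r \<Longrightarrow> integrable M (f w)"
    and int_deriv: "integrable M (\<lambda>x. deriv (\<lambda>w. f w x) z)"
    and hol: "\<And>x. x \<in> space M \<Longrightarrow> (\<lambda>w. f w x) holomorphic_on ball z r"
    and dom: "integrable M g" "\<And>w x. w \<in> ball z r \<Longrightarrow> x \<in> space M \<Longrightarrow> norm (f w x) \<le> g x"
    and w_near: "w \<in> ball z (r / 2)" "w \<noteq> z"
  shows "norm (((\<integral>x. f w x \<partial>M) - (\<integral>x. f z x \<partial>M)) / (w - z) - (\<integral>x. deriv (\<lambda>w. f w x) z \<partial>M))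
    \<le> (\<integral>x. 8 * g x / r\<^sup>2 \<partial>M) * norm (w - z)"
proof -
  have "r > 0" using w_near(1) zero_le_dist[of z w] unfolding mem_ball by linarith
  then have ints: "integrable M (f w)" "integrable M (f z)" using w_near by (auto intro!: int)
  then have "((\<integral>x. f w x \<partial>M) - (\<integral>x. f z x \<partial>M)) / (w - z) - (\<integral>x. deriv (\<lambda>w. f w x) z \<partial>M) =
      (\<integral>x. (f w x - f z x) / (w - z) - deriv (\<lambda>w. f w x) z \<partial>M)"
    using int_deriv by simp
  also have "norm \<dots> \<le> (\<integral>x. 8 * g x / r\<^sup>2 * norm (w - z) \<partial>M)"
  proof (rule order_trans[OF integral_norm_bound integral_mono])
    show "norm ((f w x - f z x) / (w - z) - deriv (\<lambda>w. f w x) z) \<le> 8 * g x / r\<^sup>2 * norm (w - z)"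
      if "x \<in> space M" for x
      using dom(2) that by (intro norm_difference_quotient_error_le hol w_near) auto
  qed (use ints int_deriv dom(1) in auto)
  finally show ?thesis using \<open>r > 0\<close> by simp
qed

lemma DERIV_integral_holomorphic:
  fixes f :: "complex \<Rightarrow> 'a \<Rightarrow> complex"
  assumes "r > 0"
    and meas: "\<And>w. w \<in> ball z r \<Longrightarrow> f w \<in> borel_measurable M"
    and hol: "\<And>x. x \<in> space M \<Longrightarrow> (\<lambda>w. f w x) holomorphic_on ball z r"
    and dom: "integrable M g" "\<And>w x. w \<in> ball z r \<Longrightarrow> x \<in> space M \<Longrightarrow> norm (f w x) \<le> g x"
  shows "((\<lambda>w. \<integral>x. f w x \<partial>M) has_field_derivative (\<integral>x. deriv (\<lambda>w. f w x) z \<partial>M)) (at z)"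
proof -
  let ?F = "\<lambda>w. \<integral>x. f w x \<partial>M" and ?F' = "\<integral>x. deriv (\<lambda>w. f w x) z \<partial>M"
  have center: "z \<in> ball z r" "z \<in> ball z (r / 2)" using \<open>r > 0\<close> by auto
  have int: "integrable M (f w)" if "w \<in> ball z r" for w
    using order_trans[OF dom(2)[OF that] abs_ge_self]
    by (intro Bochner_Integration.integrable_bound[OF dom(1) meas[OF that]]) auto
  have "norm (deriv (\<lambda>w. f w x) z) \<le> g x / (r / 2)" if "x \<in> space M" for x
    using norm_higher_deriv_le_half_ball[OF hol[OF that] dom(2)[OF _ that] center(2), of 1] by simp
  then have int_deriv: "integrable M (\<lambda>x. deriv (\<lambda>w. f w x) z)"
    using order_trans[OF _ abs_ge_self]
    by (intro Bochner_Integration.integrable_bound[OF integrable_divide[OF dom(1), of "r / 2"]]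
        borel_measurable_deriv_param[OF open_ball center(1) meas hol] AE_I2) (auto simp del: abs_divide)
  have "((\<lambda>w. (?F w - ?F z) / (w - z) - ?F') \<longlongrightarrow> 0) (at z)"
  proof (rule Lim_null_comparison)
    have "\<forall>\<^sub>F w in at z. w \<in> ball z (r / 2) - {z}" using center(2) by (intro eventually_at_in_open) auto
    then show "\<forall>\<^sub>F w in at z. norm ((?F w - ?F z) / (w - z) - ?F') \<le> (\<integral>x. 8 * g x / r\<^sup>2 \<partial>M) * norm (w - z)"
      by eventually_elim
        (use norm_difference_quotient_integral_error_le[OF int int_deriv hol dom] in auto)
    show "((\<lambda>w. (\<integral>x. 8 * g x / r\<^sup>2 \<partial>M) * norm (w - z)) \<longlongrightarrow> 0) (at z)"
      using \<open>r > 0\<close> by (auto intro!: tendsto_eq_intros)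
  qed
  then show ?thesis
    unfolding has_field_derivative_iff by (simp only: Lim_null[symmetric])
qed

lemma holomorphic_on_integral:
  fixes f :: "complex \<Rightarrow> 'a \<Rightarrow> complex"
  assumes "open S"
    and meas: "\<And>z. z \<in> S \<Longrightarrow> f z \<in> borel_measurable M"
    and hol: "\<And>x. x \<in> space M \<Longrightarrow> (\<lambda>z. f z x) holomorphic_on S"
    and dom: "\<And>z. z \<in> S \<Longrightarrow> \<exists>r>0. \<exists>g. cball z r \<subseteq> S \<and> integrable M g \<and>
                (\<forall>w\<in>cball z r. \<forall>x\<in>space M. norm (f w x) \<le> g x)"
  shows "(\<lambda>z. \<integral>x. f z x \<partial>M) holomorphic_on S"
  unfolding holomorphic_on_open[OF \<open>open S\<close>]
proof
  fix z assume "z \<in> S"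
  then obtain r g where "r > 0" "integrable M g" "cball z r \<subseteq> S"
    and bound: "\<And>w x. w \<in> cball z r \<Longrightarrow> x \<in> space M \<Longrightarrow> norm (f w x) \<le> g x"
    using dom by meson
  have "ball z r \<subseteq> S" using ball_subset_cball \<open>cball z r \<subseteq> S\<close> by (rule order_trans)
  then have "((\<lambda>z. \<integral>x. f z x \<partial>M) has_field_derivative (\<integral>x. deriv (\<lambda>w. f w x) z \<partial>M)) (at z)"
    using \<open>r > 0\<close> \<open>integrable M g\<close> bound
    by (intro DERIV_integral_holomorphic[where r = r and g = g])
      (auto intro: meas holomorphic_on_subset[OF hol])
  then show "\<exists>F'. ((\<lambda>z. \<integral>x. f z x \<partial>M) has_field_derivative F') (at z)" ..
qed

lemma holomorphic_eq_from_reals: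
  assumes "f holomorphic_on S" "g holomorphic_on S" and domain: "open S" "connected S"
    and interval: "a < b"
    and agree: "\<And>x :: real. a < x \<Longrightarrow> x < b \<Longrightarrow> of_real x \<in> S \<and> f (of_real x) = g (of_real x)"
    and z_in: "z \<in> S"
  shows "f z = (g z :: complex)"
proof -
  define c where "c = (a + b) / 2"
  have c_between: "a < c" "c < b" using interval by (auto simp: c_def)
  have "complex_of_real c islimpt complex_of_real ` {c<..<b}"
    using c_between by (intro islimpt_isCont_image)
      (auto simp: islimpt_greaterThanLessThan1 eventually_at_filter)
  moreover have "(\<lambda>z. f z - g z) holomorphic_on S" using assms(1,2) by (rule holomorphic_on_diff)
  moreover have "complex_of_real ` {c<..<b} \<subseteq> S" "complex_of_real c \<in> S"
    using agree c_between by auto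
  ultimately have "f z - g z = 0"
    using analytic_continuation[OF _ domain, of "\<lambda>z. f z - g z" "complex_of_real ` {c<..<b}" c z] agree
      c_between z_in by fastforce
  then show ?thesis by simp
qed

lemma sums_integral_dominated:
  fixes f :: "nat \<Rightarrow> 'a \<Rightarrow> 'b :: {banach, second_countable_topology}"
  assumes int: "\<And>n. integrable M (f n)" "integrable M g"
    and coeffs: "summable C" and bound: "\<And>n x. x \<in> space M \<Longrightarrow> norm (f n x) \<le> C n * g x"
  shows "(\<lambda>n. \<integral>x. f n x \<partial>M) sums (\<integral>x. (\<Sum>n. f n x) \<partial>M)"
proof (rule sums_integral[OF int(1)])
  have "summable (\<lambda>n. norm (f n x))" if "x \<in> space M" for x
    by (rule summable_comparison_test'[where N = 0 and g = "\<lambda>n. C n * g x"])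
      (use bound[OF that] coeffs in \<open>auto intro: summable_mult2\<close>)
  then show "AE x in M. summable (\<lambda>n. norm (f n x))" by (rule AE_I2)
  show "summable (\<lambda>n. \<integral>x. norm (f n x) \<partial>M)"
  proof (rule summable_comparison_test')
    show "summable (\<lambda>n. C n * (\<integral>x. g x \<partial>M))" using coeffs by (rule summable_mult2)
    have "(\<integral>x. norm (f n x) \<partial>M) \<le> (\<integral>x. C n * g x \<partial>M)" for n
      using int bound by (intro integral_mono) auto
    then show "norm (\<integral>x. norm (f n x) \<partial>M) \<le> C n * (\<integral>x. g x \<partial>M)" for n
      by simp
  qed
qed

subsection \<open>The Gamma integral with a complex rate\<close>

lemma Re_pos_notin_nonpos_Ints: "Re z > 0 \<Longrightarrow> z \<notin> \<int>\<^sub>\<le>\<^sub>0"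
  by (auto elim!: nonpos_Ints_cases)

lemma rGamma_mult_Gamma: "Re z > 0 \<Longrightarrow> rGamma z * Gamma z = 1"
  using Re_pos_notin_nonpos_Ints[of z] by (simp add: rGamma_inverse_Gamma Gamma_eq_zero_iff)

lemma has_bochner_integral_Gamma:
  fixes z :: complex
  assumes z_pos: "Re z > 0"
  shows "has_bochner_integral lborel
    (\<lambda>t. indicator {0<..} t *\<^sub>R (of_real t powr (z - 1) / of_real (exp t))) (Gamma z)"
    (is "has_bochner_integral _ ?f _")
proof -
  have "?f \<in> borel_measurable lborel"
    by (auto intro!: borel_measurable_continuous_on_indicator continuous_intros)
  then have int: "integrable lborel ?f"
    using absolutely_integrable_Gamma_integral'[OF z_pos]
    by (simp add: set_integrable_def integrable_completion)
  moreover have "integral\<^sup>L lborel ?f = Gamma z"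
  proof (rule has_integral_unique)
    show "(?f has_integral integral\<^sup>L lborel ?f) UNIV"
      by (rule has_integral_integral_lborel[OF int])
    have "((\<lambda>t. if t \<in> {0<..} then complex_of_real t powr (z - 1) / of_real (exp t) else 0)
        has_integral Gamma z) UNIV"
      using Gamma_integral_complex'[OF z_pos] by (simp only: has_integral_restrict_UNIV)
    then show "(?f has_integral Gamma z) UNIV"
      by (rule has_integral_eq[rotated]) simp
  qed
  ultimately show ?thesis by (simp add: has_bochner_integral_iff)
qed

definition Gamma_integrand :: "complex \<Rightarrow> complex \<Rightarrow> real \<Rightarrow> complex" where
  "Gamma_integrand z k t = indicator {0<..} t *\<^sub>R (of_real t powr (z - 1) * exp (- (k * of_real t)))"

lemma Gamma_integrand_measurable: "Gamma_integrand z k \<in> borel_measurable lborel"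
  unfolding Gamma_integrand_def [abs_def]
  by (auto intro!: borel_measurable_continuous_on_indicator continuous_intros)

lemma norm_Gamma_integrand_le:
  assumes "r \<le> Re k"
  shows "norm (Gamma_integrand z k t) \<le> norm (Gamma_integrand (of_real (Re z)) (of_real r) t)"
  using assms
  by (auto simp: Gamma_integrand_def indicator_def norm_mult norm_powr_real_powr
      intro!: mult_left_mono mult_right_mono)

lemma Gamma_integrand_of_real:
  "Gamma_integrand (of_real x) (of_real k) t = of_real (norm (Gamma_integrand (of_real x) (of_real k) t))"
proof -
  have "complex_of_real t powr (of_real x - 1) = of_real (t powr (x - 1))" if "t > 0"
    using that powr_of_real[of t "x - 1"] by simp
  then show ?thesis
    by (auto simp: Gamma_integrand_def indicator_def norm_mult simp flip: exp_of_real)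
qed

lemma has_bochner_integral_Gamma_integrand_real_rate:
  assumes z_pos: "Re z > 0" and k_pos: "k > 0"
  shows "has_bochner_integral lborel (Gamma_integrand z (of_real k)) (Gamma z * of_real k powr (- z))"
proof -
  define f where "f t =
      indicator {0<..} t *\<^sub>R (complex_of_real t powr (z - 1) / of_real (exp t))" for t :: real
  have "has_bochner_integral lborel f (Gamma z)"
    unfolding f_def by (rule has_bochner_integral_Gamma[OF z_pos])
  then have "has_bochner_integral lborel (\<lambda>t. f (0 + k * t)) (Gamma z /\<^sub>R \<bar>k\<bar>)"
    using k_pos by (subst (asm) lborel_has_bochner_integral_real_affine_iff[of k _ _ 0]) simp_all
  then have "has_bochner_integral lborel (\<lambda>t. of_real k powr (1 - z) * f (k * t))
      (of_real k powr (1 - z) * (Gamma z /\<^sub>R \<bar>k\<bar>))"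
    by (intro has_bochner_integral_mult_right) simp
  also have "(\<lambda>t. of_real k powr (1 - z) * f (k * t)) = Gamma_integrand z (of_real k)"
  proof
    fix t :: real
    have "of_real k powr (1 - z) * of_real k powr (z - 1) = (1 :: complex)"
      using k_pos by (simp flip: powr_add)
    moreover have "complex_of_real (k * t) powr (z - 1) = of_real k powr (z - 1) * of_real t powr (z - 1)"
      using k_pos by (simp add: powr_times_real_left)
    moreover have "indicator {0<..} (k * t) = (indicator {0<..} t :: real)"
      using k_pos by (simp add: indicator_def zero_less_mult_iff)
    ultimately show "of_real k powr (1 - z) * f (k * t) = Gamma_integrand z (of_real k) t"
      by (simp add: f_def Gamma_integrand_def exp_minus divide_inverse flip: exp_of_real mult.assoc)
  qed
  also have "of_real k powr (1 - z) * (Gamma z /\<^sub>R \<bar>k\<bar>) = Gamma z * of_real k powr (- z)"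
    using k_pos by (simp add: scaleR_conv_of_real powr_diff powr_minus field_simps)
  finally show ?thesis .
qed

lemma holomorphic_on_integral_Gamma_integrand:
  assumes z_pos: "Re z > 0"
  shows "(\<lambda>k. \<integral>t. Gamma_integrand z k t \<partial>lborel) holomorphic_on {k. Re k > 0}"
proof (rule holomorphic_on_integral)
  show "(\<lambda>k. Gamma_integrand z k t) holomorphic_on {k. Re k > 0}" for t
    unfolding Gamma_integrand_def scaleR_conv_of_real by (intro holomorphic_intros)
  fix w assume "w \<in> {k. Re k > 0}"
  then have w_pos: "Re w / 2 > 0" by simp
  have Re_ge: "Re w / 2 \<le> Re k" if "k \<in> cball w (Re w / 2)" for k
    using that abs_Re_le_cmod[of "w - k"] by (simp add: dist_norm)
  let ?g = "\<lambda>t. norm (Gamma_integrand (of_real (Re z)) (of_real (Re w / 2)) t)"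
  have "integrable lborel ?g"
    using has_bochner_integral_Gamma_integrand_real_rate[of "of_real (Re z)", OF _ w_pos] z_pos
    by (intro integrable_norm) (auto simp: has_bochner_integral_iff)
  then show "\<exists>r>0. \<exists>g. cball w r \<subseteq> {k. Re k > 0} \<and> integrable lborel g \<and>
      (\<forall>k\<in>cball w r. \<forall>t\<in>space lborel. norm (Gamma_integrand z k t) \<le> g t)"
    using w_pos Re_ge order_less_le_trans[OF w_pos Re_ge]
    by (intro exI[of _ "Re w / 2"] exI[of _ ?g] conjI ballI norm_Gamma_integrand_le) auto
qed (rule open_halfspace_Re_gt Gamma_integrand_measurable)+

lemma integral_Gamma_integrand:
  assumes z_pos: "Re z > 0" and k_pos: "Re k > 0"
  shows "(\<integral>t. Gamma_integrand z k t \<partial>lborel) = Gamma z * k powr (- z)"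
proof (rule holomorphic_eq_from_reals[where S = "{k. Re k > 0}" and a = 0 and b = 1 and z = k])
  show "open {k. Re k > 0}" "connected {k. Re k > 0}"
    by (simp_all add: open_halfspace_Re_gt connected_halfspace_Re_gt)
  show "(\<lambda>k. Gamma z * k powr (- z)) holomorphic_on {k. Re k > 0}"
    by (intro holomorphic_intros) (auto simp: complex_nonpos_Reals_iff)
  show "(\<lambda>k. \<integral>t. Gamma_integrand z k t \<partial>lborel) holomorphic_on {k. Re k > 0}"
    by (rule holomorphic_on_integral_Gamma_integrand[OF z_pos])
  fix x :: real assume "0 < x" "x < 1"
  then show "of_real x \<in> {k. Re k > 0} \<and> (\<integral>t. Gamma_integrand z (of_real x) t \<partial>lborel) =
      Gamma z * of_real x powr (- z)"
    using has_bochner_integral_Gamma_integrand_real_rate[OF z_pos \<open>0 < x\<close>]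
    by (simp add: has_bochner_integral_iff)
qed (use k_pos in auto)

lemma norm_Gamma_powr_le:
  assumes z_pos: "Re z > 0" and k_ge_1: "Re k \<ge> 1"
  shows "norm (Gamma z * k powr (- z)) \<le> Gamma (Re z)"
proof -
  let ?g = "Gamma_integrand (of_real (Re z)) (of_real 1)"
  have majorant: "has_bochner_integral lborel ?g (of_real (Gamma (Re z)))"
    using has_bochner_integral_Gamma_integrand_real_rate[of "of_real (Re z)" 1] z_pos
    by (simp flip: Gamma_complex_of_real)
  then have "has_bochner_integral lborel (\<lambda>t. complex_of_real (norm (?g t))) (of_real (Gamma (Re z)))"
    by (simp only: Gamma_integrand_of_real[symmetric])
  then have norm_g: "(\<integral>t. norm (?g t) \<partial>lborel) = Gamma (Re z)"
    by (simp only: has_bochner_integral_iff integral_complex_of_real of_real_eq_iff)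
  have "norm (Gamma z * k powr (- z)) = norm (\<integral>t. Gamma_integrand z k t \<partial>lborel)"
    using z_pos k_ge_1 by (simp add: integral_Gamma_integrand)
  also have "\<dots> \<le> (\<integral>t. norm (?g t) \<partial>lborel)"
    using majorant k_ge_1
    by (intro order_trans[OF integral_norm_bound integral_mono'] norm_Gamma_integrand_le)
      (auto simp: has_bochner_integral_iff)
  finally show ?thesis by (simp only: norm_g)
qed

subsection \<open>The complex Beta integral\<close>

abbreviation unit_lebesgue :: "real measure" where
  "unit_lebesgue \<equiv> lebesgue_on {0<..<1}"

definition beta_weight :: "'a \<Rightarrow> 'a \<Rightarrow> real \<Rightarrow> 'a :: ln" where
  "beta_weight a b t = of_real t powr (a - 1) * of_real (1 - t) powr (b - 1)"

lemma beta_weight_measurable: "beta_weight a b \<in> borel_measurable unit_lebesgue" for a b :: complex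
  unfolding beta_weight_def [abs_def]
  by (intro continuous_imp_measurable_on_sets_lebesgue continuous_intros) auto

lemma beta_weight_pos: "t \<in> {0<..<1} \<Longrightarrow> beta_weight a b t > 0" for a b :: real
  by (simp add: beta_weight_def)

lemma norm_beta_weight: "t \<in> {0<..<1} \<Longrightarrow> norm (beta_weight a b t) = beta_weight (Re a) (Re b) t"
  by (simp add: beta_weight_def norm_mult norm_powr_real_powr del: of_real_diff)

lemma beta_weight_of_real:
  "t \<in> {0<..<1} \<Longrightarrow> beta_weight (of_real a) (of_real b) t = complex_of_real (beta_weight a b t)"
  using powr_of_real[of t "a - 1"] powr_of_real[of "1 - t" "b - 1"] by (simp add: beta_weight_def)

lemma beta_weight_antimono:
  fixes a b :: real
  assumes "t \<in> {0<..<1}" "a \<le> a'" "b \<le> b'"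
  shows "beta_weight a' b' t \<le> beta_weight a b t"
  using assms by (auto simp: beta_weight_def intro!: mult_mono powr_mono')

lemma beta_weight_power:
  fixes a b :: complex
  assumes "t \<in> {0<..<1}"
  shows "beta_weight a b t * of_real t ^ n = beta_weight (a + of_nat n) b t"
  using assms by (simp add: beta_weight_def powr_add powr_diff)

lemma beta_weight_ratio_power:
  fixes a b :: complex
  assumes "t \<in> {0<..<1}"
  shows "beta_weight a b t * of_real (t / (1 - t)) ^ n = beta_weight (a + of_nat n) (b - of_nat n) t"
  using assms by (simp add: beta_weight_def powr_add powr_diff power_divide mult_ac)

lemma has_bochner_integral_beta_weight_real:
  fixes a b :: real
  assumes "a > 0" "b > 0"
  shows "has_bochner_integral unit_lebesgue (beta_weight a b) (Beta a b)"
proof -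
  have beta: "(beta_weight a b has_integral Beta a b) {0<..<1}"
    using has_integral_Beta_real[OF assms] by (simp add: beta_weight_def[abs_def] has_integral_Icc_iff_Ioo)
  then have "beta_weight a b absolutely_integrable_on {0<..<1}"
    using beta_weight_pos
    by (intro nonnegative_absolutely_integrable_1 less_imp_le) (auto simp: integrable_on_def)
  then have "integrable unit_lebesgue (beta_weight a b)"
    by (rule absolutely_integrable_imp_integrable) simp
  moreover from this have "integral\<^sup>L unit_lebesgue (beta_weight a b) = Beta a b"
    using beta by (intro has_integral_unique[OF has_integral_integral_lebesgue_on]) auto
  ultimately show ?thesis by (simp add: has_bochner_integral_iff)
qed

lemma integrable_beta_weight:
  assumes "Re a > 0" "Re b > 0"
  shows "integrable unit_lebesgue (beta_weight a b)"
  using has_bochner_integral_beta_weight_real[OF assms]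
  by (intro Bochner_Integration.integrable_bound[OF _ beta_weight_measurable])
     (auto simp: has_bochner_integral_iff norm_beta_weight)

lemma holomorphic_on_integral_beta_weight:
  fixes a b :: "complex \<Rightarrow> complex"
  assumes open_S: "open S" and hol: "a holomorphic_on S" "b holomorphic_on S"
    and pos: "\<And>s. s \<in> S \<Longrightarrow> Re (a s) > 0" "\<And>s. s \<in> S \<Longrightarrow> Re (b s) > 0"
  shows "(\<lambda>s. \<integral>t. beta_weight (a s) (b s) t \<partial>unit_lebesgue) holomorphic_on S"
proof (rule holomorphic_on_integral[OF open_S beta_weight_measurable])
  show "(\<lambda>s. beta_weight (a s) (b s) t) holomorphic_on S" for t
    unfolding beta_weight_def by (intro holomorphic_intros hol)
  fix z assume "z \<in> S"
  then obtain r where cball_subset: "r > 0" "cball z r \<subseteq> S"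
    using open_S by (auto simp: open_contains_cball)
  have cont: "continuous_on (cball z r) a" "continuous_on (cball z r) b"
    using hol cball_subset(2) by (auto intro: holomorphic_on_imp_continuous_on holomorphic_on_subset)
  have nonempty: "cball z r \<noteq> {}" using cball_subset(1) by simp
  obtain s1 where min_a: "s1 \<in> cball z r" "\<And>s. s \<in> cball z r \<Longrightarrow> Re (a s1) \<le> Re (a s)"
    using continuous_attains_inf[OF compact_cball nonempty continuous_on_Re[OF cont(1)]] by blast
  obtain s2 where min_b: "s2 \<in> cball z r" "\<And>s. s \<in> cball z r \<Longrightarrow> Re (b s2) \<le> Re (b s)"
    using continuous_attains_inf[OF compact_cball nonempty continuous_on_Re[OF cont(2)]] by blast
  have "integrable unit_lebesgue (beta_weight (Re (a s1)) (Re (b s2)))"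
    using has_bochner_integral_beta_weight_real[OF pos(1)[OF subsetD[OF cball_subset(2) min_a(1)]]
        pos(2)[OF subsetD[OF cball_subset(2) min_b(1)]]]
    by (simp add: has_bochner_integral_iff)
  then show "\<exists>r>0. \<exists>g. cball z r \<subseteq> S \<and> integrable unit_lebesgue g \<and>
      (\<forall>s\<in>cball z r. \<forall>t\<in>space unit_lebesgue. norm (beta_weight (a s) (b s) t) \<le> g t)"
    using cball_subset min_a(2) min_b(2)
    by (intro exI[of _ r] exI[of _ "beta_weight (Re (a s1)) (Re (b s2))"])
       (auto simp: norm_beta_weight intro!: beta_weight_antimono)
qed

theorem integral_beta_weight:
  assumes a_pos: "Re a > 0" and b_pos: "Re b > 0"
  shows "(\<integral>t. beta_weight a b t \<partial>unit_lebesgue) = Beta a b"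
proof -
  have halfspace: "open {z. Re z > 0}" "connected {z. Re z > 0}"
    by (simp_all add: open_halfspace_Re_gt connected_halfspace_Re_gt)
  have real: "(\<integral>t. beta_weight (of_real x) (of_real y) t \<partial>unit_lebesgue) =
      Beta (of_real x) (complex_of_real y)"
    if "x > 0" "y > 0" for x y
  proof -
    have "(\<integral>t. beta_weight (of_real x) (of_real y) t \<partial>unit_lebesgue) =
        (\<integral>t. complex_of_real (beta_weight x y t) \<partial>unit_lebesgue)"
      by (intro Bochner_Integration.integral_cong) (auto simp: beta_weight_of_real)
    then show ?thesis
      using has_bochner_integral_beta_weight_real[OF that]
      by (simp add: has_bochner_integral_iff Beta_complex_of_real)
  qed
  have complex_left: "(\<integral>t. beta_weight a (of_real y) t \<partial>unit_lebesgue) = Beta a (of_real y)"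
    if y_pos: "y > 0" for y
    by (rule holomorphic_eq_from_reals[OF _ _ halfspace, of _ _ 0 1])
       (use a_pos y_pos in \<open>auto intro!: holomorphic_on_integral_beta_weight halfspace
         holomorphic_intros Re_pos_notin_nonpos_Ints simp: real\<close>)
  show ?thesis
    by (rule holomorphic_eq_from_reals[OF _ _ halfspace, of _ _ 0 1])
       (use a_pos b_pos in \<open>auto intro!: holomorphic_on_integral_beta_weight halfspace
         holomorphic_intros Re_pos_notin_nonpos_Ints simp: complex_left\<close>)
qed

subsection \<open>Euler's integral and the regularised hypergeometric function\<close>

definition slit_plane :: "complex set" where
  "slit_plane = - (of_real ` {1..})"

lemma slit_plane_iff: "w \<in> slit_plane \<longleftrightarrow> 1 - w \<notin> \<real>\<^sub>\<le>\<^sub>0"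
proof -
  have "w \<in> of_real ` {1..}" if "1 - w \<in> \<real>\<^sub>\<le>\<^sub>0"
    using that by (intro image_eqI[of _ _ "Re w"]) (auto simp: complex_nonpos_Reals_iff complex_eq_iff)
  then show ?thesis by (auto simp: slit_plane_def complex_nonpos_Reals_iff)
qed

lemma open_slit_plane: "open slit_plane"
  unfolding slit_plane_def by (intro open_Compl closed_slot_right)

lemma slit_plane_scale:
  assumes "w \<in> slit_plane" "t \<in> {0..1}"
  shows "w * of_real t \<in> slit_plane"
proof (rule ccontr)
  assume "w * of_real t \<notin> slit_plane"
  then have outside: "Re w * t \<ge> 1" "Im w * t = 0" by (auto simp: slit_plane_iff complex_nonpos_Reals_iff)
  then have "Re w > 0"
    using assms(2) zero_less_mult_iff[of "Re w" t] by auto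
  then have "Re w * t \<le> Re w"
    using assms(2) by (intro mult_left_le) auto
  then show False using outside assms(1) by (auto simp: slit_plane_iff complex_nonpos_Reals_iff)
qed

lemma zero_in_slit_plane: "0 \<in> slit_plane"
  by (simp add: slit_plane_iff)

lemma connected_slit_plane: "connected slit_plane"
proof (rule starlike_imp_connected)
  have "closed_segment 0 w \<subseteq> slit_plane" if "w \<in> slit_plane" for w
    using slit_plane_scale[OF that] by (auto simp: closed_segment_def scaleR_conv_of_real mult.commute)
  then show "starlike slit_plane"
    unfolding starlike_def using zero_in_slit_plane by blast
qed

lemma ball_subset_slit_plane: "ball 0 1 \<subseteq> slit_plane"
proof
  fix w :: complex assume "w \<in> ball 0 1"
  then show "w \<in> slit_plane"
    using complex_Re_le_cmod[of w] by (auto simp: slit_plane_iff complex_nonpos_Reals_iff)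
qed

definition Euler_integrand :: "complex \<Rightarrow> complex \<Rightarrow> complex \<Rightarrow> complex \<Rightarrow> real \<Rightarrow> complex" where
  "Euler_integrand a b c w t = beta_weight b (c - b) t * (1 - w * of_real t) powr (- a)"

definition Euler_integral :: "complex \<Rightarrow> complex \<Rightarrow> complex \<Rightarrow> complex \<Rightarrow> complex" where
  "Euler_integral a b c w = (\<integral>t. Euler_integrand a b c w t \<partial>unit_lebesgue)"

lemma continuous_on_slit_plane_powr:
  "continuous_on (slit_plane \<times> {0..1}) (\<lambda>(w, t). (1 - w * of_real t) powr (- a))"
proof -
  have "1 - w * of_real t \<notin> \<real>\<^sub>\<le>\<^sub>0" if "w \<in> slit_plane" "t \<in> {0..1}" for w t
    using slit_plane_scale[OF that] by (simp add: slit_plane_iff)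
  then show ?thesis
    unfolding split_beta
    by (intro continuous_on_powr_complex continuous_intros)
       (fastforce simp: complex_nonpos_Reals_iff simp del: atLeastAtMost_iff)+
qed

lemma Euler_integrand_measurable:
  assumes "w \<in> slit_plane"
  shows "Euler_integrand a b c w \<in> borel_measurable unit_lebesgue"
proof -
  have "continuous_on {0<..<1} (\<lambda>t. (1 - w * of_real t) powr (- a))"
    using assms by (intro
        continuous_on_compose2[OF continuous_on_slit_plane_powr, of _ "\<lambda>t. (w, t)", simplified]
        continuous_intros) auto
  then show ?thesis
    unfolding Euler_integrand_def [abs_def]
    by (intro borel_measurable_times beta_weight_measurable continuous_imp_measurable_on_sets_lebesgue) auto
qed

lemma Euler_integrand_bounded:
  assumes "compact K" "K \<subseteq> slit_plane"
  obtains B where "\<And>w t. w \<in> K \<Longrightarrow> t \<in> space unit_lebesgue \<Longrightarrow>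
    norm (Euler_integrand a b c w t) \<le> norm (beta_weight b (c - b) t) * B"
proof -
  have "continuous_on (K \<times> {0..1}) (\<lambda>(w, t). (1 - w * of_real t) powr (- a))"
    using assms(2) by (intro continuous_on_subset[OF continuous_on_slit_plane_powr]) auto
  then have "bounded ((\<lambda>(w, t). (1 - w * of_real t) powr (- a)) ` (K \<times> {0..1}))"
    using assms(1) by (intro compact_imp_bounded compact_continuous_image compact_Times) auto
  then obtain B where "\<And>w t. w \<in> K \<Longrightarrow> t \<in> {0..1} \<Longrightarrow> norm ((1 - w * of_real t) powr (- a)) \<le> B"
    unfolding bounded_iff by fastforce
  then show ?thesis
    by (intro that[of B]) (auto simp: Euler_integrand_def norm_mult intro!: mult_left_mono)
qed

lemma integrable_Euler_integrand:
  assumes "0 < Re b" "Re b < Re c" "w \<in> slit_plane"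
  shows "integrable unit_lebesgue (Euler_integrand a b c w)"
proof -
  obtain B where "\<And>t. t \<in> space unit_lebesgue \<Longrightarrow>
      norm (Euler_integrand a b c w t) \<le> norm (beta_weight b (c - b) t) * B"
    by (rule Euler_integrand_bounded[of "{w}" a b c]) (use assms(3) in auto)
  then have "AE t in unit_lebesgue. norm (Euler_integrand a b c w t) \<le>
      norm (norm (beta_weight b (c - b) t) * B)"
    by (intro AE_I2) (auto intro: order_trans[OF _ abs_ge_self])
  moreover have "integrable unit_lebesgue (\<lambda>t. norm (beta_weight b (c - b) t) * B)"
    using assms by (intro integrable_mult_left integrable_norm integrable_beta_weight) auto
  ultimately show ?thesis
    using Bochner_Integration.integrable_bound Euler_integrand_measurable[OF assms(3)] by blast
qed

lemma holomorphic_on_Euler_integral: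
  assumes "0 < Re b" "Re b < Re c"
  shows "Euler_integral a b c holomorphic_on slit_plane"
  unfolding Euler_integral_def [abs_def]
proof (rule holomorphic_on_integral[OF open_slit_plane Euler_integrand_measurable])
  show "(\<lambda>w. Euler_integrand a b c w t) holomorphic_on slit_plane" if "t \<in> space unit_lebesgue" for t
    unfolding Euler_integrand_def
    using slit_plane_scale that by (intro holomorphic_intros) (auto simp: slit_plane_iff)
  fix z assume "z \<in> slit_plane"
  then obtain r where cball_subset: "r > 0" "cball z r \<subseteq> slit_plane"
    using open_slit_plane by (auto simp: open_contains_cball)
  obtain B where bound: "\<And>w t. w \<in> cball z r \<Longrightarrow> t \<in> space unit_lebesgue \<Longrightarrow>
      norm (Euler_integrand a b c w t) \<le> norm (beta_weight b (c - b) t) * B"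
    by (rule Euler_integrand_bounded[OF compact_cball cball_subset(2), of a b c]) blast
  have "integrable unit_lebesgue (\<lambda>t. norm (beta_weight b (c - b) t) * B)"
    using assms by (intro integrable_mult_left integrable_norm integrable_beta_weight) auto
  then show "\<exists>r>0. \<exists>g. cball z r \<subseteq> slit_plane \<and> integrable unit_lebesgue g \<and>
      (\<forall>w\<in>cball z r. \<forall>t\<in>space unit_lebesgue. norm (Euler_integrand a b c w t) \<le> g t)"
    using cball_subset bound by blast
qed

lemma summable_norm_binomial_series:
  fixes \<beta> z :: complex
  assumes "norm z < 1"
  shows "summable (\<lambda>n. norm ((\<beta> gchoose n) * z ^ n))"
proof -
  obtain r where "norm z < r" "r < 1" using dense[OF assms] by blast
  then have "norm (complex_of_real r) < 1" "norm z < norm (complex_of_real r)"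
    using norm_ge_zero[of z] by (simp_all only: norm_of_real)
  then show ?thesis
    using powser_insidea sums_summable[OF gen_binomial_complex] by blast
qed

lemma minus_gbinomial_power:
  fixes a x :: "'a :: field_char_0"
  shows "(- a gchoose n) * (- x) ^ n = pochhammer a n / fact n * x ^ n"
  by (simp add: gbinomial_pochhammer power_minus[of x] mult_ac flip: power_add mult_2)

lemma sums_Euler_integral:
  assumes params: "0 < Re b" "Re b < Re c" and "norm w < 1"
  shows "(\<lambda>n. pochhammer a n / fact n * w ^ n * Beta (b + of_nat n) (c - b)) sums Euler_integral a b c w"
proof -
  define f where "f n t = ((- a gchoose n) * (- w) ^ n) * beta_weight (b + of_nat n) (c - b) t" for n t
  have "(\<lambda>n. \<integral>t. f n t \<partial>unit_lebesgue) sums (\<integral>t. (\<Sum>n. f n t) \<partial>unit_lebesgue)"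
  proof (rule sums_integral_dominated)
    show "integrable unit_lebesgue (f n)"
      "integrable unit_lebesgue (\<lambda>t. norm (beta_weight b (c - b) t))" for n
      unfolding f_def [abs_def] using params
      by (auto intro!: integrable_mult_right integrable_norm integrable_beta_weight)
    show "summable (\<lambda>n. norm ((- a gchoose n) * (- w) ^ n))"
      using \<open>norm w < 1\<close> by (intro summable_norm_binomial_series) simp
    show "norm (f n t) \<le> norm ((- a gchoose n) * (- w) ^ n) * norm (beta_weight b (c - b) t)"
      if "t \<in> space unit_lebesgue" for n t
      using that by (auto simp: f_def norm_mult norm_beta_weight
          intro!: mult_left_mono beta_weight_antimono)
  qed
  also have "(\<integral>t. (\<Sum>n. f n t) \<partial>unit_lebesgue) = Euler_integral a b c w"
    unfolding Euler_integral_def Euler_integrand_def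
  proof (intro Bochner_Integration.integral_cong refl)
    fix t assume "t \<in> space unit_lebesgue"
    then have t_unit: "t \<in> {0<..<1}" by simp
    then have "norm (- (w * of_real t)) < 1"
      using \<open>norm w < 1\<close> mult_strict_mono[of "norm w" 1 t 1] by (auto simp: norm_mult)
    then have "(\<lambda>n. (- a gchoose n) * (- (w * of_real t)) ^ n) sums (1 - w * of_real t) powr (- a)"
      using gen_binomial_complex[of "- (w * of_real t)" "- a"] by simp
    then have "(\<lambda>n. beta_weight b (c - b) t * ((- a gchoose n) * (- (w * of_real t)) ^ n)) sums
        (beta_weight b (c - b) t * (1 - w * of_real t) powr (- a))"
      by (rule sums_mult)
    moreover have "beta_weight b (c - b) t * ((- a gchoose n) * (- (w * of_real t)) ^ n) = f n t" for n
      using beta_weight_power[OF t_unit, of b "c - b" n]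
      by (simp add: f_def power_minus[of w] power_minus[of "w * of_real t"] power_mult_distrib)
    ultimately show "(\<Sum>n. f n t) = beta_weight b (c - b) t * (1 - w * of_real t) powr (- a)"
      by (simp add: sums_iff)
  qed
  also have "(\<lambda>n. \<integral>t. f n t \<partial>unit_lebesgue) =
      (\<lambda>n. pochhammer a n / fact n * w ^ n * Beta (b + of_nat n) (c - b))"
    using params by (simp add: f_def integral_beta_weight minus_gbinomial_power)
  finally show ?thesis .
qed

definition hyp2F1_fps :: "complex \<Rightarrow> complex \<Rightarrow> complex \<Rightarrow> complex fps" where
  "hyp2F1_fps a b c = Abs_fps (\<lambda>n. pochhammer a n * pochhammer b n * rGamma (c + of_nat n) / fact n)"

lemma sums_hyp2F1_fps_Euler_integral:
  assumes b_pos: "0 < Re b" and b_less_c: "Re b < Re c" and "norm w < 1"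
  shows "(\<lambda>n. fps_nth (hyp2F1_fps a b c) n * w ^ n)
      sums (rGamma b * rGamma (c - b) * Euler_integral a b c w)"
proof -
  have "rGamma b * rGamma (c - b) * (pochhammer a n / fact n * w ^ n * Beta (b + of_nat n) (c - b)) =
      fps_nth (hyp2F1_fps a b c) n * w ^ n" for n
  proof -
    have "rGamma (b + of_nat n) * Gamma (b + of_nat n) = 1" "rGamma (c - b) * Gamma (c - b) = 1"
      using b_pos b_less_c by (auto intro!: rGamma_mult_Gamma)
    moreover have "rGamma b * rGamma (c - b)
        * (pochhammer a n / fact n * w ^ n * Beta (b + of_nat n) (c - b)) =
        fps_nth (hyp2F1_fps a b c) n * w ^ n * (rGamma (b + of_nat n) * Gamma (b + of_nat n))
            * (rGamma (c - b) * Gamma (c - b))"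
      by (simp add: pochhammer_rGamma[of b n] Beta_altdef hyp2F1_fps_def algebra_simps)
    ultimately show ?thesis by (simp only: mult_1_right)
  qed
  then show ?thesis
    using sums_mult[OF sums_Euler_integral[OF assms, of a], of "rGamma b * rGamma (c - b)"] by simp
qed

lemma
  assumes b_pos: "0 < Re b" and b_less_c: "Re b < Re c"
  shows holomorphic_hyp2F1_reg_Euler: "hyp2F1_reg a b c holomorphic_on slit_plane"
    and sums_hyp2F1_reg_Euler: "norm w < 1 \<Longrightarrow> (\<lambda>n. fps_nth (hyp2F1_fps a b c) n * w ^ n)
        sums hyp2F1_reg a b c w"
proof -
  let ?continuation = "\<lambda>f. f holomorphic_on slit_plane \<and>
      (\<forall>w. norm w < 1 \<longrightarrow> f w = (\<Sum>n. fps_nth (hyp2F1_fps a b c) n * w ^ n))"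
  have Euler_continuation: "?continuation (\<lambda>w. rGamma b * rGamma (c - b) * Euler_integral a b c w)"
    using sums_hyp2F1_fps_Euler_integral[OF assms]
    by (auto simp: sums_iff intro!: holomorphic_intros holomorphic_on_Euler_integral assms)
  have "hyp2F1_reg a b c = (SOME f. ?continuation f)"
    by (simp add: hyp2F1_reg_def hyp2F1_fps_def slit_plane_def Compl_eq_Diff_UNIV)
  then have reg_continuation: "?continuation (hyp2F1_reg a b c)"
    using someI[of ?continuation, OF Euler_continuation] by simp
  then show "hyp2F1_reg a b c holomorphic_on slit_plane" by simp
  show "norm w < 1 \<Longrightarrow> (\<lambda>n. fps_nth (hyp2F1_fps a b c) n * w ^ n) sums hyp2F1_reg a b c w"
    using sums_hyp2F1_fps_Euler_integral[OF assms, of w a] reg_continuation by (simp add: sums_iff)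
qed

theorem hyp2F1_reg_eq_Euler_integral:
  assumes b_pos: "0 < Re b" and b_less_c: "Re b < Re c" and w_in: "w \<in> slit_plane"
  shows "Gamma b * Gamma (c - b) * hyp2F1_reg a b c w = Euler_integral a b c w"
proof -
  have "Gamma b * Gamma (c - b) * hyp2F1_reg a b c w =
      Gamma b * Gamma (c - b) * (rGamma b * rGamma (c - b) * Euler_integral a b c w)"
  proof (rule holomorphic_eq_from_reals[where a = 0 and b = 1 and z = w,
        OF _ _ open_slit_plane connected_slit_plane])
    show "(\<lambda>w. Gamma b * Gamma (c - b) * hyp2F1_reg a b c w) holomorphic_on slit_plane"
      "(\<lambda>w. Gamma b * Gamma (c - b) * (rGamma b * rGamma (c - b) * Euler_integral a b c w))
          holomorphic_on slit_plane"
      by (intro holomorphic_intros holomorphic_on_Euler_integral holomorphic_hyp2F1_reg_Euler assms)+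
    fix x :: real assume "0 < x" "x < 1"
    then have "norm (complex_of_real x) < 1" by simp
    then show "of_real x \<in> slit_plane \<and> Gamma b * Gamma (c - b) * hyp2F1_reg a b c (of_real x) =
        Gamma b * Gamma (c - b) * (rGamma b * rGamma (c - b) * Euler_integral a b c (of_real x))"
      using sums_unique2[OF sums_hyp2F1_reg_Euler sums_hyp2F1_fps_Euler_integral, OF b_pos b_less_c _ b_pos
          b_less_c]
        ball_subset_slit_plane by (auto simp del: norm_of_real)
  qed (use w_in in auto)
  also have "\<dots> = (rGamma b * Gamma b) * (rGamma (c - b) * Gamma (c - b)) * Euler_integral a b c w"
    by (simp only: mult_ac)
  finally show ?thesis
    using b_pos b_less_c by (simp add: rGamma_mult_Gamma)
qed

lemma hyp2F1_reg_commute: "hyp2F1_reg a b c = hyp2F1_reg b a c"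
  unfolding hyp2F1_reg_def by (simp only: mult.commute[of "pochhammer a _"])

definition Euler_representable :: "complex \<Rightarrow> complex \<Rightarrow> complex \<Rightarrow> bool" where
  "Euler_representable a b c \<longleftrightarrow> 0 < Re a \<and> Re a < Re c \<or> 0 < Re b \<and> Re b < Re c"

lemma hyp2F1_fps_commute: "hyp2F1_fps a b c = hyp2F1_fps b a c"
  by (simp add: hyp2F1_fps_def mult.commute)

lemma holomorphic_on_hyp2F1_reg:
  assumes "Euler_representable a b c"
  shows "hyp2F1_reg a b c holomorphic_on slit_plane"
  using assms holomorphic_hyp2F1_reg_Euler[of a c b] holomorphic_hyp2F1_reg_Euler[of b c a]
  by (auto simp: Euler_representable_def hyp2F1_reg_commute[of a])

lemma sums_hyp2F1_reg:
  assumes "Euler_representable a b c" "norm w < 1"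
  shows "(\<lambda>n. fps_nth (hyp2F1_fps a b c) n * w ^ n) sums hyp2F1_reg a b c w"
  using assms sums_hyp2F1_reg_Euler[of a c w b] sums_hyp2F1_reg_Euler[of b c w a]
  by (auto simp: Euler_representable_def hyp2F1_reg_commute[of a] hyp2F1_fps_commute[of a])

lemma has_fps_expansion_hyp2F1_reg:
  assumes "Euler_representable a b c"
  shows "hyp2F1_reg a b c has_fps_expansion hyp2F1_fps a b c"
proof (rule has_fps_expansionI)
  have "eventually (\<lambda>w. w \<in> ball 0 1) (nhds (0 :: complex))"
    by (intro eventually_nhds_in_open) auto
  then show "eventually (\<lambda>w. (\<lambda>n. fps_nth (hyp2F1_fps a b c) n * w ^ n) sums hyp2F1_reg a b c w) (nhds 0)"
    by eventually_elim (simp add: sums_hyp2F1_reg[OF assms])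
qed

subsection \<open>The hypergeometric equation and a quadratic transformation\<close>

definition hyp2F1_operator :: "complex \<Rightarrow> complex \<Rightarrow> complex \<Rightarrow> (complex \<Rightarrow> complex) \<Rightarrow> complex \<Rightarrow> complex" where
  "hyp2F1_operator a b c f z =
     z * (1 - z) * deriv (deriv f) z + (c - (a + b + 1) * z) * deriv f z - a * b * f z"

definition hyp2F1_operator_fps :: "complex \<Rightarrow> complex \<Rightarrow> complex \<Rightarrow> complex fps \<Rightarrow> complex fps" where
  "hyp2F1_operator_fps a b c F =
     fps_X * (1 - fps_X) * fps_deriv (fps_deriv F)
         + (fps_const c - fps_const (a + b + 1) * fps_X) * fps_deriv F
       - fps_const (a * b) * F"

lemma has_fps_expansion_hyp2F1_operator:
  assumes "f has_fps_expansion F"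
  shows "hyp2F1_operator a b c f has_fps_expansion hyp2F1_operator_fps a b c F"
  unfolding hyp2F1_operator_def [abs_def] hyp2F1_operator_fps_def
  by (intro fps_expansion_intros assms)

lemma hyp2F1_operator_fps_nth:
  "fps_nth (hyp2F1_operator_fps a b c F) n =
     of_nat (Suc n) * (c + of_nat n) * fps_nth F (Suc n) - (a + of_nat n) * (b + of_nat n) * fps_nth F n"
proof -
  have expand: "hyp2F1_operator_fps a b c F =
      fps_X * fps_deriv (fps_deriv F) - fps_X * (fps_X * fps_deriv (fps_deriv F))
          + fps_const c * fps_deriv F
      - fps_const (a + b + 1) * (fps_X * fps_deriv F) - fps_const (a * b) * F"
    by (simp add: hyp2F1_operator_fps_def algebra_simps)
  show ?thesis
    unfolding expand by (cases n; cases "n - 1") (simp_all add: algebra_simps)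
qed

lemma hyp2F1_operator_fps_hyp2F1_fps: "hyp2F1_operator_fps a b c (hyp2F1_fps a b c) = 0"
proof (rule fps_ext)
  fix n
  have "of_nat (Suc n) * (c + of_nat n) * fps_nth (hyp2F1_fps a b c) (Suc n) =
      pochhammer a (Suc n) * pochhammer b (Suc n) * ((c + of_nat n) * rGamma (c + of_nat (Suc n)))
          * (of_nat (Suc n) / fact (Suc n))"
    by (simp add: hyp2F1_fps_def mult_ac del: of_nat_Suc fact_Suc pochhammer_Suc)
  also have "of_nat (Suc n) / fact (Suc n) = 1 / (fact n :: complex)"
    by (simp del: of_nat_Suc)
  also have "pochhammer a (Suc n) * pochhammer b (Suc n) * ((c + of_nat n) * rGamma (c + of_nat (Suc n)))
      * (1 / fact n) =
      (a + of_nat n) * (b + of_nat n) * fps_nth (hyp2F1_fps a b c) n"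
    using rGamma_plus1[of "c + of_nat n"]
    by (simp add: add.assoc add.commute[of 1] pochhammer_Suc hyp2F1_fps_def)
  finally show "fps_nth (hyp2F1_operator_fps a b c (hyp2F1_fps a b c)) n = fps_nth 0 n"
    by (simp add: hyp2F1_operator_fps_nth)
qed

lemma hyp2F1_fps_unique:
  assumes c_nonpole: "c \<notin> \<int>\<^sub>\<le>\<^sub>0" and ode: "hyp2F1_operator_fps a b c F = 0"
    and init: "fps_nth F 0 = rGamma c"
  shows "F = hyp2F1_fps a b c"
proof (rule fps_ext)
  fix n show "fps_nth F n = fps_nth (hyp2F1_fps a b c) n"
  proof (induction n)
    case 0
    show ?case by (simp add: init hyp2F1_fps_def)
  next
    case (Suc n)
    have step: "of_nat (Suc n) * (c + of_nat n) * fps_nth G (Suc n) =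
        (a + of_nat n) * (b + of_nat n) * fps_nth G n"
      if "hyp2F1_operator_fps a b c G = 0" for G
      using hyp2F1_operator_fps_nth[of a b c G n] that by simp
    have "c + of_nat n \<noteq> 0" using c_nonpole by (auto simp: add_eq_0_iff2)
    moreover have "of_nat (Suc n) * (c + of_nat n) * fps_nth F (Suc n) =
        of_nat (Suc n) * (c + of_nat n) * fps_nth (hyp2F1_fps a b c) (Suc n)"
      by (simp only: step[OF ode] step[OF hyp2F1_operator_fps_hyp2F1_fps] Suc.IH)
    ultimately show ?case by (simp del: of_nat_Suc)
  qed
qed

lemma eventually_hyp2F1_operator_hyp2F1_reg:
  assumes "Euler_representable a b c"
  shows "eventually (\<lambda>z. hyp2F1_operator a b c (hyp2F1_reg a b c) z = 0) (nhds 0)"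
  using has_fps_expansion_hyp2F1_operator[OF has_fps_expansion_hyp2F1_reg[OF assms], of a b c]
  by (simp add: hyp2F1_operator_fps_hyp2F1_fps has_fps_expansion_0_iff)

lemma eventually_eq_hyp2F1_reg:
  assumes ana: "f analytic_on {0}" and init: "f 0 = rGamma c"
    and ode: "eventually (\<lambda>z. hyp2F1_operator a b c f z = 0) (nhds 0)"
    and c_nonpole: "c \<notin> \<int>\<^sub>\<le>\<^sub>0" and Euler: "Euler_representable a b c"
  shows "eventually (\<lambda>z. f z = hyp2F1_reg a b c z) (nhds 0)"
proof -
  define F where "F = fps_expansion f 0"
  have F_expansion: "f has_fps_expansion F"
    unfolding F_def using ana by (rule analytic_at_imp_has_fps_expansion_0)
  have "hyp2F1_operator_fps a b c F = 0"
    using has_fps_expansion_hyp2F1_operator[OF F_expansion, of a b c] ode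
    by (metis fps_expansion_unique_complex has_fps_expansion_0_iff)
  moreover have "fps_nth F 0 = rGamma c"
    using has_fps_expansion_imp_0_eq_fps_nth_0[OF F_expansion] init by simp
  ultimately have "F = hyp2F1_fps a b c" by (rule hyp2F1_fps_unique[OF c_nonpole])
  then have "(\<lambda>z. f z - hyp2F1_reg a b c z) has_fps_expansion 0"
    using has_fps_expansion_diff[OF F_expansion has_fps_expansion_hyp2F1_reg[OF Euler]] by simp
  then show ?thesis by (simp add: has_fps_expansion_0_iff)
qed

lemma deriv_weighted_compose:
  fixes f P p p' \<zeta> \<zeta>' \<zeta>'' :: "complex \<Rightarrow> complex"
  assumes open_S: "open S" and f_holo: "open T" "f holomorphic_on T" "\<And>y. y \<in> S \<Longrightarrow> \<zeta> y \<in> T"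
    and P_deriv: "\<And>y. y \<in> S \<Longrightarrow> (P has_field_derivative P y * p y) (at y)"
    and p_deriv: "\<And>y. y \<in> S \<Longrightarrow> (p has_field_derivative p' y) (at y)"
    and \<zeta>_deriv: "\<And>y. y \<in> S \<Longrightarrow> (\<zeta> has_field_derivative \<zeta>' y) (at y)"
    and \<zeta>'_deriv: "\<And>y. y \<in> S \<Longrightarrow> (\<zeta>' has_field_derivative \<zeta>'' y) (at y)"
    and y_in: "y \<in> S"
  shows "deriv (\<lambda>y. P y * f (\<zeta> y)) y = P y * (p y * f (\<zeta> y) + \<zeta>' y * deriv f (\<zeta> y))"
    and "deriv (deriv (\<lambda>y. P y * f (\<zeta> y))) y =
      P y * (((p y)\<^sup>2 + p' y) * f (\<zeta> y) + (2 * p y * \<zeta>' y + \<zeta>'' y) * deriv f (\<zeta> y)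
          + (\<zeta>' y)\<^sup>2 * deriv (deriv f) (\<zeta> y))"
proof -
  have f\<zeta>: "((\<lambda>y. g (\<zeta> y)) has_field_derivative deriv g (\<zeta> y) * \<zeta>' y) (at y)"
    if "y \<in> S" "g holomorphic_on T" for g y
    using that f_holo by (intro DERIV_chain2[OF holomorphic_derivI \<zeta>_deriv]) auto
  have deriv_f_holo: "deriv f holomorphic_on T" using f_holo(2,1) by (rule holomorphic_deriv)
  have first: "deriv (\<lambda>y. P y * f (\<zeta> y)) y = P y * (p y * f (\<zeta> y) + \<zeta>' y * deriv f (\<zeta> y))" if "y \<in> S" for y
    by (rule DERIV_imp_deriv)
       (auto intro!: derivative_eq_intros f\<zeta> P_deriv f_holo(2) that simp: algebra_simps)
  show "deriv (\<lambda>y. P y * f (\<zeta> y)) y = P y * (p y * f (\<zeta> y) + \<zeta>' y * deriv f (\<zeta> y))"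
    using y_in by (rule first)
  have "eventually (\<lambda>y. y \<in> S) (nhds y)" using open_S y_in by (rule eventually_nhds_in_open)
  then have "eventually (\<lambda>y. deriv (\<lambda>y. P y * f (\<zeta> y)) y =
      P y * (p y * f (\<zeta> y) + \<zeta>' y * deriv f (\<zeta> y))) (nhds y)"
    by eventually_elim (rule first)
  then have "deriv (deriv (\<lambda>y. P y * f (\<zeta> y))) y =
      deriv (\<lambda>y. P y * (p y * f (\<zeta> y) + \<zeta>' y * deriv f (\<zeta> y))) y"
    by (rule deriv_cong_ev) simp
  also have "\<dots> =
      P y * (((p y)\<^sup>2 + p' y) * f (\<zeta> y) + (2 * p y * \<zeta>' y + \<zeta>'' y) * deriv f (\<zeta> y)
          + (\<zeta>' y)\<^sup>2 * deriv (deriv f) (\<zeta> y))"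
    by (rule DERIV_imp_deriv)
       (auto intro!: derivative_eq_intros f\<zeta> deriv_f_holo P_deriv p_deriv \<zeta>'_deriv f_holo(2) y_in
           simp: algebra_simps power2_eq_square)
  finally show "deriv (deriv (\<lambda>y. P y * f (\<zeta> y))) y = \<dots>" .
qed

lemma square_notin_nonpos_Reals:
  assumes "Re z > 0"
  shows "z\<^sup>2 \<notin> \<real>\<^sub>\<le>\<^sub>0"
proof
  assume "z\<^sup>2 \<in> \<real>\<^sub>\<le>\<^sub>0"
  then have "(Re z)\<^sup>2 - (Im z)\<^sup>2 \<le> 0" "2 * Re z * Im z = 0"
    by (simp_all only: complex_nonpos_Reals_iff Re_power2 Im_power2)
  then show False using assms by (auto simp: power2_eq_square mult_le_0_iff)
qed

definition quadratic_arg :: "complex \<Rightarrow> complex" where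
  "quadratic_arg y = 1 - 1 / (1 - 2 * y)\<^sup>2"

definition quadratic_weight :: "complex \<Rightarrow> complex \<Rightarrow> complex \<Rightarrow> complex" where
  "quadratic_weight a c y = (1 - 2 * y) powr (- 2 * a) * (1 - y) powr (c - 1)"

lemma quadratic_nonpole:
  fixes y :: complex
  assumes "y \<in> ball 0 (1/2)"
  shows "1 - 2 * y \<notin> \<real>\<^sub>\<le>\<^sub>0" "1 - y \<notin> \<real>\<^sub>\<le>\<^sub>0" "1 - 2 * y \<noteq> 0" "1 - y \<noteq> 0"
proof -
  show "1 - 2 * y \<notin> \<real>\<^sub>\<le>\<^sub>0" "1 - y \<notin> \<real>\<^sub>\<le>\<^sub>0"
    using assms complex_Re_le_cmod[of y] by (auto simp: complex_nonpos_Reals_iff)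
  then show "1 - 2 * y \<noteq> 0" "1 - y \<noteq> 0"
    by (metis nonpos_Reals_zero_I)+
qed

lemma quadratic_arg_in_slit_plane:
  assumes y_in: "y \<in> ball 0 (1/2)"
  shows "quadratic_arg y \<in> slit_plane"
proof -
  have "Re (1 - 2 * y) > 0" using y_in complex_Re_le_cmod[of y] by simp
  then have "Re (1 / (1 - 2 * y)) > 0"
    using quadratic_nonpole(3)[OF y_in] by (simp add: Re_divide' del: minus_complex.simps)
  then have "(1 / (1 - 2 * y))\<^sup>2 \<notin> \<real>\<^sub>\<le>\<^sub>0" by (rule square_notin_nonpos_Reals)
  then show ?thesis by (simp add: slit_plane_iff quadratic_arg_def power_divide)
qed

lemma DERIV_powr_linear:
  fixes y k s :: complex
  assumes "1 - k * y \<notin> \<real>\<^sub>\<le>\<^sub>0"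
  shows "((\<lambda>y. (1 - k * y) powr s)
      has_field_derivative (1 - k * y) powr s * (- (s * k) / (1 - k * y))) (at y)"
  using assms by (auto intro!: derivative_eq_intros simp: powr_diff)

lemma DERIV_quadratic_weight:
  assumes "y \<in> ball 0 (1/2)"
  shows "(quadratic_weight a c has_field_derivative
    quadratic_weight a c y * (4 * a / (1 - 2 * y) - (c - 1) / (1 - y))) (at y)"
proof -
  have "((\<lambda>y. (1 - 2 * y) powr (- 2 * a) * (1 - 1 * y) powr (c - 1)) has_field_derivative
      (1 - 2 * y) powr (- 2 * a) * (- (- 2 * a * 2) / (1 - 2 * y)) * (1 - 1 * y) powr (c - 1) +
      (1 - 1 * y) powr (c - 1) * (- ((c - 1) * 1) / (1 - 1 * y)) * (1 - 2 * y) powr (- 2 * a)) (at y)"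
    using quadratic_nonpole[OF assms] by (intro DERIV_mult DERIV_powr_linear) simp_all
  from DERIV_cong[OF this] show ?thesis
    using quadratic_nonpole[OF assms] by (simp add: quadratic_weight_def [abs_def] field_simps)
qed

lemma DERIV_divide_power_linear:
  fixes y k m :: complex
  assumes "1 - m * y \<noteq> 0"
  shows "((\<lambda>y. k / (1 - m * y) ^ n) has_field_derivative m * of_nat n * k / (1 - m * y) ^ Suc n) (at y)"
proof -
  have inverse_power: "((\<lambda>u. k * inverse u ^ n)
      has_field_derivative - (of_nat n * k) * inverse u ^ Suc n) (at u)"
    if "u \<noteq> 0" for u :: complex
    using that
    by (cases n; auto intro!: derivative_eq_intros simp: mult_ac simp del: power_Suc of_nat_Suc; simp)
  have "((\<lambda>y. k * inverse (1 - m * y) ^ n)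
      has_field_derivative - (of_nat n * k) * inverse (1 - m * y) ^ Suc n * - m) (at y)"
  proof (rule DERIV_chain2[where f = "\<lambda>u. k * inverse u ^ n" and g = "\<lambda>y. 1 - m * y",
        OF inverse_power[OF assms]])
    show "((\<lambda>y. 1 - m * y) has_field_derivative - m) (at y)"
      by (auto intro!: derivative_eq_intros)
  qed
  then show ?thesis
    by (simp add: divide_inverse power_inverse mult_ac)
qed

text \<open>
  The substitution multiplies the hypergeometric operator by \<open>- 4 / e\<^sup>2\<close>, where \<open>e = 1 - 2 y\<close>; the
  three identities compare the coefficients of the second derivative, of the first derivative and of
  the function itself.
\<close>
lemma quadratic_operator_coefficients:
  fixes a c e :: complex
  assumes "e \<noteq> 0" "1 + e \<noteq> 0"
  defines "y \<equiv> (1 - e) / 2"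
  defines "z \<equiv> 1 - 1 / e\<^sup>2" and "z' \<equiv> - 4 / e ^ 3" and "z'' \<equiv> - 24 / e ^ 4"
    and "p \<equiv> 4 * a / e - (c - 1) / (1 - y)" and "p' \<equiv> 8 * a / e\<^sup>2 - (c - 1) / (1 - y)\<^sup>2"
  shows "y * (1 - y) * z'\<^sup>2 = - 4 / e\<^sup>2 * (z * (1 - z))"
    "y * (1 - y) * (2 * p * z' + z'') + (c - 2 * y) * z' = - 4 / e\<^sup>2 * (c - (2 * a + 3 / 2) * z)"
    "y * (1 - y) * (p\<^sup>2 + p') + (c - 2 * y) * p - (c - 2 * a) * (2 * a - c + 1) =
        - 4 / e\<^sup>2 * (- a * (a + 1/2))"
proof -
  have one_minus_y: "1 - y = (1 + e) / 2" by (simp add: y_def field_simps)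
  show "y * (1 - y) * z'\<^sup>2 = - 4 / e\<^sup>2 * (z * (1 - z))"
    unfolding one_minus_y using assms(1,2) by (simp add: y_def z_def z'_def field_simps eval_nat_numeral)
  show "y * (1 - y) * (2 * p * z' + z'') + (c - 2 * y) * z' = - 4 / e\<^sup>2 * (c - (2 * a + 3 / 2) * z)"
    unfolding p_def one_minus_y using assms(1,2)
    by (simp add: y_def z_def z'_def z''_def divide_simps) (simp add: algebra_simps eval_nat_numeral)
  show "y * (1 - y) * (p\<^sup>2 + p') + (c - 2 * y) * p - (c - 2 * a) * (2 * a - c + 1) =
      - 4 / e\<^sup>2 * (- a * (a + 1/2))"
    unfolding p_def p'_def one_minus_y using assms(1,2)
    by (simp add: y_def divide_simps) (simp add: algebra_simps eval_nat_numeral)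
qed

lemma DERIV_quadratic:
  fixes a c y :: complex
  assumes "y \<in> ball 0 (1/2)"
  shows "(quadratic_arg has_field_derivative - 4 / (1 - 2 * y) ^ 3) (at y)"
    and "((\<lambda>y. - 4 / (1 - 2 * y) ^ 3) has_field_derivative - 24 / (1 - 2 * y) ^ 4) (at y)"
    and "((\<lambda>y. 4 * a / (1 - 2 * y) - (c - 1) / (1 - y)) has_field_derivative
      8 * a / (1 - 2 * y)\<^sup>2 - (c - 1) / (1 - y)\<^sup>2) (at y)"
proof -
  note nonzero = quadratic_nonpole(3,4)[OF assms]
  show "(quadratic_arg has_field_derivative - 4 / (1 - 2 * y) ^ 3) (at y)"
    using DERIV_diff[OF DERIV_const[of 1] DERIV_divide_power_linear[OF nonzero(1), of 1 2]]
    by (simp add: quadratic_arg_def [abs_def] eval_nat_numeral)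
  show "((\<lambda>y. - 4 / (1 - 2 * y) ^ 3) has_field_derivative - 24 / (1 - 2 * y) ^ 4) (at y)"
    using DERIV_divide_power_linear[OF nonzero(1), of "- 4" 3] by (simp add: eval_nat_numeral)
  show "((\<lambda>y. 4 * a / (1 - 2 * y) - (c - 1) / (1 - y)) has_field_derivative
      8 * a / (1 - 2 * y)\<^sup>2 - (c - 1) / (1 - y)\<^sup>2) (at y)"
    using DERIV_diff[OF DERIV_divide_power_linear[OF nonzero(1), of "4 * a" 1]
        DERIV_divide_power_linear[of 1 y "c - 1" 1]] nonzero(2)
    by (simp add: power2_eq_square)
qed

lemma hyp2F1_operator_quadratic:
  assumes f_holo: "f holomorphic_on slit_plane" and y_in: "y \<in> ball 0 (1/2)"
  shows "hyp2F1_operator (c - 2 * a) (2 * a - c + 1) c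
      (\<lambda>y. quadratic_weight a c y * f (quadratic_arg y)) y =
    - 4 / (1 - 2 * y)\<^sup>2 * quadratic_weight a c y * hyp2F1_operator (a + 1/2) a c f (quadratic_arg y)"
proof -
  define h where "h y = quadratic_weight a c y * f (quadratic_arg y)" for y
  define e W z where "e = 1 - 2 * y" and "W = quadratic_weight a c y" and "z = quadratic_arg y"
  define p p' where "p = 4 * a / (1 - 2 * y) - (c - 1) / (1 - y)"
    and "p' = 8 * a / (1 - 2 * y)\<^sup>2 - (c - 1) / (1 - y)\<^sup>2"
  define z' z'' where "z' = - 4 / (1 - 2 * y) ^ 3" and "z'' = - 24 / (1 - 2 * y) ^ 4"
  have derivs: "deriv h y = W * (p * f z + z' * deriv f z)"
    "deriv (deriv h) y = W * ((p\<^sup>2 + p') * f z + (2 * p * z' + z'') * deriv f z + z'\<^sup>2 * deriv (deriv f) z)"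
    unfolding h_def W_def z_def p_def p'_def z'_def z''_def
    by (rule deriv_weighted_compose[OF open_ball open_slit_plane f_holo quadratic_arg_in_slit_plane
          DERIV_quadratic_weight DERIV_quadratic(3,1,2) y_in]; assumption)+
  have e_facts: "e \<noteq> 0" "1 + e \<noteq> 0" "(1 - e) / 2 = y" "1 - 1 / e\<^sup>2 = z"
    using quadratic_nonpole[OF y_in] by (auto simp: e_def z_def quadratic_arg_def)
  note coefficients = quadratic_operator_coefficients[OF e_facts(1,2), unfolded e_facts(3,4)]
  have "hyp2F1_operator (c - 2 * a) (2 * a - c + 1) c h y =
      W * (y * (1 - y) * z'\<^sup>2 * deriv (deriv f) z
          + (y * (1 - y) * (2 * p * z' + z'') + (c - 2 * y) * z') * deriv f z
      + (y * (1 - y) * (p\<^sup>2 + p') + (c - 2 * y) * p - (c - 2 * a) * (2 * a - c + 1)) * f z)"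
    unfolding hyp2F1_operator_def derivs unfolding h_def W_def z_def by (simp add: algebra_simps)
  also have "\<dots> = W * (- 4 / e\<^sup>2 * (z * (1 - z)) * deriv (deriv f) z
      + - 4 / e\<^sup>2 * (c - (2 * a + 3 / 2) * z) * deriv f z + - 4 / e\<^sup>2 * (- a * (a + 1/2)) * f z)"
    using coefficients by (simp only: p_def p'_def z'_def z''_def e_def)
  also have "\<dots> = - 4 / e\<^sup>2 * W * hyp2F1_operator (a + 1/2) a c f z"
    unfolding hyp2F1_operator_def using e_facts(1) by (simp add: field_simps)
  finally show ?thesis by (simp only: h_def [abs_def] e_def W_def z_def)
qed

theorem eventually_quadratic_transformation:
  assumes Euler: "Euler_representable (a + 1/2) a c" "Euler_representable (c - 2 * a) (2 * a - c + 1) c"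
    and c_pos: "Re c > 0"
  shows "eventually (\<lambda>y. quadratic_weight a c y * hyp2F1_reg (a + 1/2) a c (quadratic_arg y) =
    hyp2F1_reg (c - 2 * a) (2 * a - c + 1) c y) (nhds 0)"
proof (rule eventually_eq_hyp2F1_reg)
  let ?f = "hyp2F1_reg (a + 1/2) a c"
  have f_holo: "?f holomorphic_on slit_plane" using Euler(1) by (rule holomorphic_on_hyp2F1_reg)
  have arg_holo: "quadratic_arg holomorphic_on ball 0 (1/2)"
    unfolding quadratic_arg_def using quadratic_nonpole by (intro holomorphic_intros) auto
  have "quadratic_weight a c holomorphic_on ball 0 (1/2)"
    unfolding quadratic_weight_def using quadratic_nonpole by (intro holomorphic_intros) auto
  moreover have "(\<lambda>y. ?f (quadratic_arg y)) holomorphic_on ball 0 (1/2)"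
    using holomorphic_on_compose_gen[OF arg_holo f_holo] quadratic_arg_in_slit_plane
    by (simp add: o_def image_subset_iff)
  ultimately have "(\<lambda>y. quadratic_weight a c y * ?f (quadratic_arg y)) holomorphic_on ball 0 (1/2)"
    by (rule holomorphic_on_mult)
  then show "(\<lambda>y. quadratic_weight a c y * ?f (quadratic_arg y)) analytic_on {0}"
    unfolding analytic_on_def by (auto intro!: exI[of _ "1/2"])
  show "quadratic_weight a c 0 * ?f (quadratic_arg 0) = rGamma c"
    using sums_unique2[OF sums_hyp2F1_reg[OF Euler(1), of 0] powser_sums_zero]
    by (simp add: quadratic_weight_def quadratic_arg_def hyp2F1_fps_def)
  have "isCont quadratic_arg 0"
    using arg_holo by (rule holomorphic_on_imp_continuous_on [THEN continuous_on_interior]) simp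
  then have "filterlim quadratic_arg (nhds 0) (nhds 0)"
    by (simp add: isCont_def tendsto_nhds_iff quadratic_arg_def)
  then have "eventually (\<lambda>y. hyp2F1_operator (a + 1/2) a c ?f (quadratic_arg y) = 0) (nhds 0)"
    using eventually_hyp2F1_operator_hyp2F1_reg[OF Euler(1)] by (rule eventually_compose_filterlim[rotated])
  moreover have "eventually (\<lambda>y. y \<in> ball 0 (1/2)) (nhds (0 :: complex))"
    by (intro eventually_nhds_in_open) auto
  ultimately show "eventually (\<lambda>y. hyp2F1_operator (c - 2 * a) (2 * a - c + 1) c
      (\<lambda>y. quadratic_weight a c y * ?f (quadratic_arg y)) y = 0) (nhds 0)"
    by eventually_elim (simp only: hyp2F1_operator_quadratic[OF f_holo] mult_zero_right)
qed (use Euler c_pos in \<open>auto simp: Re_pos_notin_nonpos_Ints\<close>)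

subsection \<open>The Legendre function as a hypergeometric function\<close>

lemma open_D1: "open D1" and connected_D1: "connected D1"
proof -
  have D1_eq: "D1 = {\<xi>. Re \<xi> > 0} \<inter> ({\<xi>. Im \<xi> > - pi} \<inter> {\<xi>. Im \<xi> < pi})"
    by (auto simp: D1_def abs_less_iff)
  show "open D1"
    unfolding D1_eq by (intro open_Int open_halfspace_Re_gt open_halfspace_Im_gt open_halfspace_Im_lt)
  show "connected D1"
    unfolding D1_eq by (intro convex_connected convex_Int convex_halfspace_Re_gt convex_halfspace_Im_gt
        convex_halfspace_Im_lt)
qed

lemma Re_Im_sinh: "Re (sinh z) = sinh (Re z) * cos (Im z)" "Im (sinh z) = cosh (Re z) * sin (Im z)"
  and Re_Im_cosh: "Re (cosh z) = cosh (Re z) * cos (Im z)" "Im (cosh z) = sinh (Re z) * sin (Im z)"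
  by (simp_all add: sinh_field_def cosh_field_def Re_exp Im_exp field_simps)

lemma sin_Im_D1: "\<xi> \<in> D1 \<Longrightarrow> sin (Im \<xi>) = 0 \<Longrightarrow> Im \<xi> = 0"
  unfolding D1_def using sin_eq_0_pi[of "Im \<xi>"] by auto

lemma sinh_notin_nonpos_Reals_D1:
  assumes "\<xi> \<in> D1"
  shows "sinh \<xi> \<notin> \<real>\<^sub>\<le>\<^sub>0"
proof
  assume "sinh \<xi> \<in> \<real>\<^sub>\<le>\<^sub>0"
  then have "sinh (Re \<xi>) \<le> 0"
    using sin_Im_D1[OF assms] by (auto simp: complex_nonpos_Reals_iff Re_Im_sinh)
  then show False using assms by (simp add: D1_def)
qed

lemma sinh_nonzero_D1: "\<xi> \<in> D1 \<Longrightarrow> sinh \<xi> \<noteq> 0"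
  using sinh_notin_nonpos_Reals_D1[of \<xi>] by auto

lemma cosh_notin_cut_D1:
  assumes "\<xi> \<in> D1"
  shows "cosh \<xi> \<notin> of_real ` {..1}"
proof
  assume "cosh \<xi> \<in> of_real ` {..1}"
  then have "sinh (Re \<xi>) * sin (Im \<xi>) = 0" "cosh (Re \<xi>) * cos (Im \<xi>) \<le> 1"
    by (auto simp flip: Re_Im_cosh)
  then have "cosh (Re \<xi>) \<le> 1"
    using assms sin_Im_D1[OF assms] by (auto simp: D1_def)
  then show False using assms cosh_real_strict_mono[of 0 "Re \<xi>"] by (simp add: D1_def)
qed

lemma Re_exp_div_sinh_pos:
  assumes "Re \<xi> > 0"
  shows "Re (exp \<xi> / (2 * sinh \<xi>)) > 0"
proof -
  have exp_less_1: "norm (exp (- (2 * \<xi>))) < 1" using assms by simp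
  have "sinh \<xi> = exp \<xi> * ((1 - exp (- (2 * \<xi>))) / 2)"
    by (simp add: sinh_field_def algebra_simps flip: exp_add)
  then have "exp \<xi> / (2 * sinh \<xi>) = 1 / (1 - exp (- (2 * \<xi>)))" by (simp only:) simp
  moreover have "Re (1 - exp (- (2 * \<xi>))) > 0"
    using le_less_trans[OF complex_Re_le_cmod exp_less_1] by simp
  ultimately show ?thesis by (auto simp: Re_divide' complex_eq_iff simp del: minus_complex.simps exp_minus)
qed

lemma plus_of_real_notin_nonpos_Reals:
  fixes z :: complex
  assumes "z \<notin> of_real ` {..1}" "t \<ge> - 1"
  shows "z + of_real t \<notin> \<real>\<^sub>\<le>\<^sub>0"
proof
  assume "z + of_real t \<in> \<real>\<^sub>\<le>\<^sub>0"
  then have "z = of_real (Re z)" "Re z \<le> 1"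
    using assms(2) by (auto simp: complex_nonpos_Reals_iff complex_eq_iff)
  then show False using assms(1) by blast
qed

lemma inverse_square_in_slit_plane:
  fixes z :: complex
  assumes "z \<notin> of_real ` {..1}"
  shows "1 / z\<^sup>2 \<in> slit_plane"
proof (rule ccontr)
  assume "1 / z\<^sup>2 \<notin> slit_plane"
  then obtain r where r_eq: "r \<ge> 1" "1 / z\<^sup>2 = of_real r" by (auto simp: slit_plane_def)
  then have "z\<^sup>2 = of_real (1 / r)"
    by (metis inverse_eq_divide inverse_inverse_eq of_real_inverse)
  also have "\<dots> = (of_real (sqrt (1 / r)))\<^sup>2"
    using r_eq(1) by (simp flip: of_real_power)
  finally have "z\<^sup>2 = (of_real (sqrt (1 / r)))\<^sup>2" .
  then have "z = of_real (sqrt (1 / r)) \<or> z = of_real (- sqrt (1 / r))"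
    by (simp add: power2_eq_iff)
  moreover have "0 \<le> sqrt (1 / r)" "sqrt (1 / r) \<le> 1" using r_eq(1) by auto
  then have "sqrt (1 / r) \<le> 1" "- sqrt (1 / r) \<le> 1" by linarith+
  ultimately show False using assms by blast
qed

lemma Euler_representable_legendre:
  assumes "\<bar>Re \<mu>\<bar> < Re \<nu> + 1"
  shows "Euler_representable ((\<nu> + \<mu> + 2) / 2) ((\<nu> + \<mu> + 1) / 2) (\<nu> + 3/2)"
    and "Euler_representable (1/2 - \<mu>) (1/2 + \<mu>) (\<nu> + 3/2)"
  using assms by (auto simp: Euler_representable_def)

lemma holomorphic_on_legendre_Q:
  assumes "\<bar>Re \<mu>\<bar> < Re \<nu> + 1"
  shows "legendre_Q \<nu> \<mu> holomorphic_on - (of_real ` {..1})"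
proof -
  note holo_F = holomorphic_on_compose_gen[OF _
      holomorphic_on_hyp2F1_reg[OF Euler_representable_legendre(1)[OF assms]], unfolded o_def]
  have "z - 1 \<notin> \<real>\<^sub>\<le>\<^sub>0" "z \<notin> \<real>\<^sub>\<le>\<^sub>0" "z + 1 \<notin> \<real>\<^sub>\<le>\<^sub>0"
    if "z \<in> - (of_real ` {..1})" for z :: complex
    using that plus_of_real_notin_nonpos_Reals[of z "-1"] plus_of_real_notin_nonpos_Reals[of z 0]
      plus_of_real_notin_nonpos_Reals[of z 1] by simp_all
  then show ?thesis
    unfolding legendre_Q_def [abs_def] using inverse_square_in_slit_plane
    by (intro holomorphic_intros holo_F) (auto simp: powr_def)
qed

lemma powr_of_real_eq_exp: "r > 0 \<Longrightarrow> complex_of_real r powr z = exp (z * of_real (ln r))"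
  by (simp add: powr_def Ln_of_real)

definition legendre_prefactor :: "complex \<Rightarrow> complex \<Rightarrow> complex" where
  "legendre_prefactor \<nu> \<xi> = csqrt (of_real pi / (2 * sinh \<xi>)) * exp (- ((\<nu> + 1/2) * \<xi>))"

lemma csqrt_pi_div_two_sinh:
  assumes "x > 0"
  shows "csqrt (of_real pi / (2 * sinh (of_real x))) =
      of_real (sqrt pi) * exp (- of_real ((ln 2 + ln (sinh x)) / 2))"
proof -
  have "sqrt (exp t) = exp (t / 2)" for t :: real
    by (intro real_sqrt_unique) (simp_all flip: exp_double)
  from this[of "ln 2 + ln (sinh x)"] have "sqrt (2 * sinh x) = exp ((ln 2 + ln (sinh x)) / 2)"
    using assms by (simp add: exp_add)
  then have "sqrt (pi / (2 * sinh x)) = sqrt pi * exp (- ((ln 2 + ln (sinh x)) / 2))"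
    by (metis real_sqrt_divide exp_minus divide_inverse)
  then show ?thesis
    unfolding csqrt_sinh_branch(2)[OF assms]
    by (simp only: of_real_mult of_real_minus exp_of_real[symmetric])
qed

lemma sinh_of_real: "sinh (complex_of_real x) = of_real (sinh x)"
  and cosh_of_real: "cosh (complex_of_real x) = of_real (cosh x)"
  by (simp_all add: sinh_field_def cosh_field_def exp_of_real flip: of_real_minus)

lemma sinh_pos_cosh_gt_1: "x > 0 \<Longrightarrow> sinh x > 0 \<and> cosh x > 1" for x :: real
  using cosh_real_strict_mono[of 0 x] by simp

lemma legendre_Q_cosh_of_real:
  assumes "x > 0"
  shows "exp (- (of_real pi * \<i> * \<mu>)) * legendre_Q \<nu> \<mu> (cosh (of_real x)) =
    of_real (sqrt pi) * Gamma (\<nu> + \<mu> + 1) *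
    exp (\<mu> * of_real (ln (sinh x)) - (\<nu> + 1) * of_real (ln 2) - (\<nu> + \<mu> + 1) * of_real (ln (cosh x))) *
    hyp2F1_reg ((\<nu> + \<mu> + 2) / 2) ((\<nu> + \<mu> + 1) / 2) (\<nu> + 3/2) (1 / (cosh (of_real x))\<^sup>2)"
proof -
  have "sinh x > 0" "cosh x > 1" using sinh_pos_cosh_gt_1[OF assms] by auto
  then have "(cosh (of_real x) - 1) powr (\<mu> / 2) * (cosh (of_real x) + 1) powr (\<mu> / 2) =
      exp (\<mu> * of_real (ln (sinh x)))"
    using legendre_power_branch(2)[of "cosh x" \<mu>] powr_of_real_eq_exp[of "(sinh x)\<^sup>2" "\<mu> / 2"]
    by (simp add: cosh_of_real cosh_square_eq ln_realpow)
  moreover have "2 powr (\<nu> + 1) = exp ((\<nu> + 1) * of_real (ln 2))"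
    using powr_of_real_eq_exp[of 2] by simp
  moreover have "cosh (of_real x) powr (\<nu> + \<mu> + 1) = exp ((\<nu> + \<mu> + 1) * of_real (ln (cosh x)))"
    using \<open>cosh x > 1\<close> by (simp add: cosh_of_real powr_of_real_eq_exp)
  ultimately show ?thesis
    by (simp add: legendre_Q_def exp_diff exp_minus)
qed

lemma one_minus_exp_div_sinh_of_real:
  assumes "x > 0"
  defines "y \<equiv> 1 - exp (complex_of_real x) / (2 * sinh (of_real x))"
  shows "1 - y = of_real (exp x / (2 * sinh x))" and "1 - 2 * y = of_real (cosh x / sinh x)"
  using assms(1)
  by (simp_all add: y_def sinh_of_real exp_of_real[symmetric]
      cosh_plus_sinh[symmetric, of "complex_of_real x"]
      cosh_of_real field_simps)

lemma quadratic_arg_one_minus_exp_div_sinh: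
  assumes "x > 0"
  shows "quadratic_arg (1 - exp (of_real x) / (2 * sinh (of_real x))) = 1 / (cosh (of_real x))\<^sup>2"
proof -
  have "quadratic_arg (1 - exp (of_real x) / (2 * sinh (of_real x))) =
      of_real (1 - (sinh x)\<^sup>2 / (cosh x)\<^sup>2)"
    unfolding quadratic_arg_def one_minus_exp_div_sinh_of_real[OF assms] by (simp add: power_divide)
  also have "1 - (sinh x)\<^sup>2 / (cosh x)\<^sup>2 = ((cosh x)\<^sup>2 - (sinh x)\<^sup>2) / (cosh x)\<^sup>2"
    using sinh_pos_cosh_gt_1[OF assms] by (simp add: diff_divide_distrib)
  also have "(cosh x)\<^sup>2 - (sinh x)\<^sup>2 = 1" by (simp add: cosh_square_eq)
  finally show ?thesis by (simp add: cosh_of_real)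
qed

lemma quadratic_weight_one_minus_exp_div_sinh:
  assumes "x > 0"
  shows "quadratic_weight a c (1 - exp (of_real x) / (2 * sinh (of_real x))) =
    exp (- 2 * a * of_real (ln (cosh x) - ln (sinh x)) + (c - 1) * of_real (x - ln 2 - ln (sinh x)))"
proof -
  have pos: "sinh x > 0" "cosh x > 0" using sinh_pos_cosh_gt_1[OF assms] by auto
  then have "ln (cosh x / sinh x) = ln (cosh x) - ln (sinh x)"
    "ln (exp x / (2 * sinh x)) = x - ln 2 - ln (sinh x)"
    by (simp_all add: ln_div ln_mult)
  with pos show ?thesis
    unfolding quadratic_weight_def one_minus_exp_div_sinh_of_real[OF assms] exp_add
    by (simp only: powr_of_real_eq_exp divide_pos_pos exp_gt_zero mult_pos_pos zero_less_numeral)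
qed

lemma legendre_Q_cosh_quadratic:
  fixes x :: real and \<mu> \<nu> :: complex
  defines "y \<equiv> 1 - exp (of_real x) / (2 * sinh (of_real x))" and "a \<equiv> (\<nu> + \<mu> + 1) / 2" and "c \<equiv> \<nu> + 3/2"
  assumes "x > 0"
  shows "exp (- (of_real pi * \<i> * \<mu>)) * legendre_Q \<nu> \<mu> (cosh (of_real x)) =
    legendre_prefactor \<nu> (of_real x) * Gamma (\<nu> + \<mu> + 1) *
    (quadratic_weight a c y * hyp2F1_reg (a + 1/2) a c (quadratic_arg y))"
proof -
  have "\<mu> * of_real (ln (sinh x)) - (\<nu> + 1) * of_real (ln 2) - (\<nu> + \<mu> + 1) * of_real (ln (cosh x)) =
      - of_real ((ln 2 + ln (sinh x)) / 2) + - ((\<nu> + 1/2) * of_real x) +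
      (- 2 * a * of_real (ln (cosh x) - ln (sinh x)) + (c - 1) * of_real (x - ln 2 - ln (sinh x)))"
    by (simp add: a_def c_def field_simps)
  moreover have "(\<nu> + \<mu> + 2) / 2 = a + 1/2" by (simp add: a_def field_simps)
  ultimately show ?thesis
    unfolding legendre_Q_cosh_of_real[OF \<open>x > 0\<close>] legendre_prefactor_def csqrt_pi_div_two_sinh[OF \<open>x > 0\<close>]
      y_def quadratic_arg_one_minus_exp_div_sinh[OF \<open>x > 0\<close>] quadratic_weight_one_minus_exp_div_sinh[OF \<open>x > 0\<close>]
    by (simp only: exp_add mult_ac flip: a_def c_def)
qed

lemma tendsto_one_minus_exp_div_sinh: "((\<lambda>x::real. 1 - exp x / (2 * sinh x)) \<longlongrightarrow> 0) at_top"
proof -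
  have "((\<lambda>x::real. - inverse (- 1 + exp (2 * x))) \<longlongrightarrow> - 0) at_top"
    by (intro tendsto_minus tendsto_inverse_0_at_top filterlim_tendsto_add_at_top[OF tendsto_const]
        filterlim_compose[OF exp_at_top] filterlim_tendsto_pos_mult_at_top[OF tendsto_const] filterlim_ident) simp
  moreover have "eventually (\<lambda>x::real. - inverse (- 1 + exp (2 * x)) = 1 - exp x / (2 * sinh x)) at_top"
    using eventually_gt_at_top[of 0]
  proof eventually_elim
    case (elim x)
    then have "exp x * exp x \<noteq> 1" by (simp flip: exp_add)
    moreover have "exp (2 * x) = exp x * exp x" by (simp flip: exp_add)
    ultimately show ?case by (simp add: sinh_field_def exp_minus divide_simps)
  qed
  ultimately have "((\<lambda>x::real. 1 - exp x / (2 * sinh x)) \<longlongrightarrow> - 0) at_top"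
    by (rule Lim_transform_eventually)
  then show ?thesis by simp
qed

lemma eventually_legendre_Q_cosh_real:
  assumes "\<bar>Re \<mu>\<bar> < Re \<nu> + 1"
  shows "eventually (\<lambda>x::real. exp (- (of_real pi * \<i> * \<mu>)) * legendre_Q \<nu> \<mu> (cosh (of_real x)) =
    legendre_prefactor \<nu> (of_real x) * Gamma (\<nu> + \<mu> + 1) *
    hyp2F1_reg (1/2 - \<mu>) (1/2 + \<mu>) (\<nu> + 3/2) (1 - exp (of_real x) / (2 * sinh (of_real x)))) at_top"
proof -
  define a c where "a = (\<nu> + \<mu> + 1) / 2" and "c = \<nu> + 3/2"
  have params: "a + 1/2 = (\<nu> + \<mu> + 2) / 2" "c - 2 * a = 1/2 - \<mu>" "2 * a - c + 1 = 1/2 + \<mu>"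
    by (simp_all add: a_def c_def field_simps)
  have "((\<lambda>x::real. of_real (1 - exp x / (2 * sinh x))) \<longlongrightarrow> complex_of_real 0) at_top"
    by (intro tendsto_of_real tendsto_one_minus_exp_div_sinh)
  then have "((\<lambda>x::real. 1 - exp (of_real x) / (2 * sinh (of_real x))) \<longlongrightarrow> (0 :: complex)) at_top"
    by (simp add: sinh_of_real flip: exp_of_real)
  moreover have "eventually (\<lambda>y. quadratic_weight a c y * hyp2F1_reg (a + 1/2) a c (quadratic_arg y) =
      hyp2F1_reg (1/2 - \<mu>) (1/2 + \<mu>) c y) (nhds 0)"
    using eventually_quadratic_transformation[of a c] Euler_representable_legendre[OF assms] assms
    unfolding params by (simp add: a_def c_def)
  ultimately have "eventually (\<lambda>x::real.
      quadratic_weight a c (1 - exp (of_real x) / (2 * sinh (of_real x))) *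
      hyp2F1_reg (a + 1/2) a c (quadratic_arg (1 - exp (of_real x) / (2 * sinh (of_real x)))) =
      hyp2F1_reg (1/2 - \<mu>) (1/2 + \<mu>) c (1 - exp (of_real x) / (2 * sinh (of_real x)))) at_top"
    by (rule eventually_compose_filterlim[rotated])
  then show ?thesis
    using eventually_gt_at_top[of 0]
    by eventually_elim (simp only: legendre_Q_cosh_quadratic a_def c_def)
qed

lemma holomorphic_on_sinh: "sinh holomorphic_on S" and holomorphic_on_cosh: "cosh holomorphic_on S"
  for S :: "complex set"
  unfolding sinh_field_def [abs_def] cosh_field_def [abs_def] by (intro holomorphic_intros; simp)+

lemma pi_div_two_sinh_notin_nonpos_Reals:
  assumes "\<xi> \<in> D1"
  shows "of_real pi / (2 * sinh \<xi>) \<notin> \<real>\<^sub>\<le>\<^sub>0"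
proof
  assume "of_real pi / (2 * sinh \<xi>) \<in> \<real>\<^sub>\<le>\<^sub>0"
  then obtain r where "r \<le> 0" "of_real pi / (2 * sinh \<xi>) = of_real r" by (auto elim: nonpos_Reals_cases)
  moreover have "sinh \<xi> \<noteq> 0" using assms by (rule sinh_nonzero_D1)
  ultimately have "sinh \<xi> = of_real (pi / (2 * r))" "pi / (2 * r) \<le> 0"
    by (auto simp: field_simps divide_nonneg_nonpos)
  then show False using sinh_notin_nonpos_Reals_D1[OF assms] nonpos_Reals_of_real_iff by metis
qed

lemma holomorphic_on_legendre_prefactor: "legendre_prefactor \<nu> holomorphic_on D1"
  unfolding legendre_prefactor_def [abs_def] using sinh_nonzero_D1 pi_div_two_sinh_notin_nonpos_Reals
  by (intro holomorphic_intros holomorphic_on_sinh) auto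

theorem legendre_Q_cosh:
  assumes "\<xi> \<in> D1" and params: "\<bar>Re \<mu>\<bar> < Re \<nu> + 1"
  shows "exp (- (of_real pi * \<i> * \<mu>)) * legendre_Q \<nu> \<mu> (cosh \<xi>) =
      legendre_prefactor \<nu> \<xi> * Gamma (\<nu> + \<mu> + 1) *
    hyp2F1_reg (1/2 - \<mu>) (1/2 + \<mu>) (\<nu> + 3/2) (1 - exp \<xi> / (2 * sinh \<xi>))"
    (is "?Q \<xi> = ?F \<xi>")
proof -
  from eventually_legendre_Q_cosh_real[OF params]
  obtain x0 where x0: "?Q (of_real x) = ?F (of_real x)" if "x \<ge> x0" for x
    unfolding eventually_at_top_linorder by blast
  have arg_in: "1 - exp \<xi> / (2 * sinh \<xi>) \<in> slit_plane" if "\<xi> \<in> D1" for \<xi>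
    using Re_exp_div_sinh_pos[of \<xi>] that by (auto simp: D1_def slit_plane_iff complex_nonpos_Reals_iff)
  note holo = holomorphic_on_compose_gen[OF _ holomorphic_on_legendre_Q[OF params], unfolded o_def]
    holomorphic_on_compose_gen[OF _ holomorphic_on_hyp2F1_reg[OF Euler_representable_legendre(2)[OF params]],
      unfolded o_def]
  show ?thesis
  proof (rule holomorphic_eq_from_reals[where S = D1 and a = "max 0 x0" and b = "max 0 x0 + 1" and z = \<xi>])
    show "?Q holomorphic_on D1"
      using cosh_notin_cut_D1 by (intro holomorphic_intros holo holomorphic_on_cosh) auto
    show "?F holomorphic_on D1"
      using arg_in sinh_nonzero_D1
      by (intro holomorphic_intros holo holomorphic_on_sinh holomorphic_on_legendre_prefactor) auto
    fix x :: real assume "max 0 x0 < x" "x < max 0 x0 + 1"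
    then show "of_real x \<in> D1 \<and> ?Q (of_real x) = ?F (of_real x)"
      using x0 by (simp add: D1_def)
  qed (use open_D1 connected_D1 \<open>\<xi> \<in> D1\<close> in auto)
qed

subsection \<open>Taylor remainders of binomials\<close>

definition binomial_remainder :: "nat \<Rightarrow> 'a \<Rightarrow> 'a \<Rightarrow> 'a :: {real_normed_field, ln}" where
  "binomial_remainder N \<beta> p = (1 + p) powr \<beta> - (\<Sum>k<N. (\<beta> gchoose k) * p ^ k)"

lemma fact_Suc_gbinomial:
  fixes \<beta> :: "'a :: field_char_0"
  shows "fact (Suc n) * (\<beta> gchoose Suc n) = fact n * (\<beta> gchoose n) * (\<beta> - of_nat n)"
  by (simp only: gbinomial_mult_fact prod.atLeast0_lessThan_Suc)

lemma binomial_remainder_has_integral: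
  fixes \<beta> p :: complex
  assumes N_pos: "N > 0" and p_nonneg: "Re p \<ge> 0"
  shows "((\<lambda>t. of_nat N * (\<beta> gchoose N) * p ^ N * of_real ((1 - t) ^ (N - 1))
      * (1 + of_real t * p) powr (\<beta> - of_nat N))
    has_integral binomial_remainder N \<beta> p) {0..1}"
proof -
  define D where "D n t =
      fact n * (\<beta> gchoose n) * p ^ n * (1 + of_real t * p) powr (\<beta> - of_nat n)" for n and t :: real
  have nonpole: "1 + of_real t * p \<notin> \<real>\<^sub>\<le>\<^sub>0" if "0 \<le> t" for t
    using mult_nonneg_nonneg[OF that p_nonneg] by (simp add: complex_nonpos_Reals_iff not_le)
  have deriv: "(D n has_vector_derivative D (Suc n) t) (at t within {0..1})" if "0 \<le> t" for n t
  proof -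
    have "((\<lambda>z. fact n * (\<beta> gchoose n) * p ^ n * (1 + z * p) powr (\<beta> - of_nat n)) has_field_derivative
        fact n * (\<beta> gchoose n) * p ^ n
            * ((\<beta> - of_nat n) * (1 + of_real t * p) powr (\<beta> - of_nat n - 1) * p)) (at (of_real t))"
      using nonpole[OF that] by (auto intro!: derivative_eq_intros)
    moreover have "fact n * (\<beta> gchoose n) * p ^ n
        * ((\<beta> - of_nat n) * (1 + of_real t * p) powr (\<beta> - of_nat n - 1) * p) = D (Suc n) t"
      unfolding D_def fact_Suc_gbinomial by (simp add: algebra_simps)
    ultimately show ?thesis
      unfolding D_def by (auto intro: has_vector_derivative_real_field)
  qed
  have "((\<lambda>t. ((1 - t) ^ (N - 1) / fact (N - 1)) *\<^sub>R D N t) has_integral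
      (1 + of_real 1 * p) powr \<beta> - (\<Sum>n<N. ((1 - 0) ^ n / fact n) *\<^sub>R D n 0)) {0..1}"
    by (rule Taylor_has_integral[OF N_pos, of D]) (use deriv in \<open>auto simp: D_def\<close>)
  also have "(1 + of_real 1 * p) powr \<beta> - (\<Sum>n<N. ((1 - 0) ^ n / fact n) *\<^sub>R D n 0) =
      binomial_remainder N \<beta> p"
    by (simp add: binomial_remainder_def D_def scaleR_conv_of_real)
  also have "(\<lambda>t. ((1 - t) ^ (N - 1) / fact (N - 1)) *\<^sub>R D N t) =
      (\<lambda>t. of_nat N * (\<beta> gchoose N) * p ^ N * of_real ((1 - t) ^ (N - 1))
          * (1 + of_real t * p) powr (\<beta> - of_nat N))"
    using N_pos by (simp add: fun_eq_iff D_def scaleR_conv_of_real fact_reduce mult_ac)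
  finally show ?thesis .
qed

lemma norm_binomial_remainder_le_sup:
  fixes \<beta> p :: complex
  assumes p_nonneg: "Re p \<ge> 0"
    and powr_le: "\<And>t. t \<in> {0..1} \<Longrightarrow> norm ((1 + of_real t * p) powr (\<beta> - of_nat N)) \<le> K"
  shows "norm (binomial_remainder N \<beta> p) \<le> norm (\<beta> gchoose N) * K * norm p ^ N"
proof (cases "N = 0")
  case True
  then show ?thesis using powr_le[of 1] by (simp add: binomial_remainder_def)
next
  case False
  define C where "C = norm (\<beta> gchoose N) * K * norm p ^ N"
  define f where "f t =
      of_nat N * (\<beta> gchoose N) * p ^ N * of_real ((1 - t) ^ (N - 1))
          * (1 + of_real t * p) powr (\<beta> - of_nat N)" for t
  have f_integral: "(f has_integral binomial_remainder N \<beta> p) {0..1}"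
    unfolding f_def using False p_nonneg by (intro binomial_remainder_has_integral) auto
  have "((\<lambda>t. C * (N * (1 - t) ^ (N - 1))) has_integral C * (- ((1 - 1) ^ N) - - ((1 - 0) ^ N))) {0..1}"
    by (intro has_integral_mult_right fundamental_theorem_of_calculus)
       (auto simp: has_real_derivative_iff_has_vector_derivative[symmetric] intro!: derivative_eq_intros)
  then have majorant_integral: "((\<lambda>t. C * (N * (1 - t) ^ (N - 1))) has_integral C) {0..1}"
    using False by (simp add: zero_power)
  have "norm (integral {0..1} f) \<le> integral {0..1} (\<lambda>t. C * (N * (1 - t) ^ (N - 1)))"
  proof (rule Henstock_Kurzweil_Integration.integral_norm_bound_integral)
    fix t :: real assume t_unit: "t \<in> {0..1}"
    have "norm (f t) \<le> norm (of_nat N * (\<beta> gchoose N) * p ^ N * of_real ((1 - t) ^ (N - 1))) * K"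
      unfolding f_def norm_mult[of "_ * of_real _"] using powr_le[OF t_unit] by (rule mult_left_mono) simp
    also have "\<dots> = C * (N * (1 - t) ^ (N - 1))"
      using t_unit by (simp add: C_def norm_mult norm_power power_abs del: of_real_power of_real_diff)
    finally show "norm (f t) \<le> C * (N * (1 - t) ^ (N - 1))" .
  qed (use f_integral majorant_integral in blast)+
  then have "norm (binomial_remainder N \<beta> p) \<le> C"
    by (simp only: integral_unique[OF f_integral] integral_unique[OF majorant_integral])
  then show ?thesis by (simp only: C_def)
qed

lemma norm_powr_le_Gamma:
  assumes "Re \<beta> < 0" "Re k \<ge> 1"
  shows "norm (k powr \<beta>) \<le> norm (rGamma (- \<beta>)) * Gamma (- Re \<beta>)"
proof -
  have "k powr \<beta> = rGamma (- \<beta>) * (Gamma (- \<beta>) * k powr (- (- \<beta>)))"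
    using rGamma_mult_Gamma[of "- \<beta>"] assms by (simp flip: mult.assoc)
  also have "norm \<dots> \<le> norm (rGamma (- \<beta>)) * Gamma (- Re \<beta>)"
    unfolding norm_mult[of "rGamma _"] using norm_Gamma_powr_le[of "- \<beta>" k] assms
    by (intro mult_left_mono) auto
  finally show ?thesis .
qed

theorem norm_binomial_remainder_le:
  fixes \<beta> p :: complex
  assumes \<beta>_less: "Re \<beta> < real N" and p_nonneg: "Re p \<ge> 0"
  shows "norm (binomial_remainder N \<beta> p) \<le> norm (rGamma (- \<beta>)) * Gamma (N - Re \<beta>) / fact N * norm p ^ N"
proof -
  have "norm (binomial_remainder N \<beta> p) \<le>
      norm (\<beta> gchoose N) * (norm (rGamma (of_nat N - \<beta>)) * Gamma (N - Re \<beta>)) * norm p ^ N"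
    using norm_powr_le_Gamma[of "\<beta> - of_nat N"] \<beta>_less p_nonneg
    by (intro norm_binomial_remainder_le_sup) auto
  also have "\<dots> = norm ((\<beta> gchoose N) * rGamma (of_nat N - \<beta>)) * Gamma (N - Re \<beta>) * norm p ^ N"
    by (simp add: norm_mult)
  also have "(\<beta> gchoose N) * rGamma (of_nat N - \<beta>) = (- 1) ^ N * rGamma (- \<beta>) / fact N"
    using pochhammer_rGamma[of "- \<beta>" N] by (simp add: gbinomial_pochhammer add.commute)
  finally show ?thesis by (simp add: norm_mult norm_divide norm_power)
qed

lemma sgn_binomial_remainder:
  fixes \<beta> p :: real
  assumes "p > 0"
  shows "sgn (binomial_remainder N \<beta> p) = sgn (\<beta> gchoose N)"
proof (cases "N = 0")
  case True
  then show ?thesis using assms by (simp add: binomial_remainder_def)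
next
  case False
  define D where "D n t = fact n * (\<beta> gchoose n) * (1 + t) powr (\<beta> - n)" for n and t :: real
  have "\<exists>t>0. t < p \<and> (1 + p) powr \<beta> = (\<Sum>n<N. D n 0 / fact n * p ^ n) + D N t / fact N * p ^ N"
  proof (rule Maclaurin[OF assms])
    show "\<forall>n t. n < N \<and> 0 \<le> t \<and> t \<le> p \<longrightarrow> (D n has_real_derivative D (Suc n) t) (at t)"
    proof (intro allI impI)
      fix n and t :: real assume "n < N \<and> 0 \<le> t \<and> t \<le> p"
      then have "(D n has_real_derivative fact n * (\<beta> gchoose n)
          * ((\<beta> - n) * (1 + t) powr (\<beta> - n - 1))) (at t)"
        unfolding D_def by (auto intro!: derivative_eq_intros)
      also have "fact n * (\<beta> gchoose n) * ((\<beta> - n) * (1 + t) powr (\<beta> - n - 1)) = D (Suc n) t"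
        unfolding D_def fact_Suc_gbinomial by (simp add: algebra_simps)
      finally show "(D n has_real_derivative D (Suc n) t) (at t)" .
    qed
  qed (use False in \<open>auto simp: D_def\<close>)
  then obtain t where "0 < t" "binomial_remainder N \<beta> p = (\<beta> gchoose N) * ((1 + t) powr (\<beta> - N) * p ^ N)"
    by (auto simp: binomial_remainder_def D_def)
  then show ?thesis using assms by (simp add: sgn_mult)
qed

subsection \<open>Expansion of the hypergeometric function with remainder\<close>

definition hyp2F1_remainder_integrand :: "nat \<Rightarrow> complex \<Rightarrow> complex \<Rightarrow> complex \<Rightarrow> complex \<Rightarrow> real \<Rightarrow> complex" where
  "hyp2F1_remainder_integrand N a b c X t =
     beta_weight b (c - a - b) t * binomial_remainder N (- a) (of_real (t / (1 - t)) * X)"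

definition hyp2F1_remainder :: "nat \<Rightarrow> complex \<Rightarrow> complex \<Rightarrow> complex \<Rightarrow> complex \<Rightarrow> complex" where
  "hyp2F1_remainder N a b c X =
     Gamma (c - a) * rGamma b * (\<integral>t. hyp2F1_remainder_integrand N a b c X t \<partial>unit_lebesgue)"

lemma Euler_integrand_eq_beta_weight:
  assumes t_unit: "t \<in> {0<..<1}"
  shows "Euler_integrand a b c (1 - X) t =
      beta_weight b (c - a - b) t * (1 + of_real (t / (1 - t)) * X) powr (- a)"
proof -
  have "1 + of_real (t / (1 - t)) * X = of_real (1 / (1 - t)) * (1 - (1 - X) * of_real t)"
    using t_unit by (simp add: field_simps)
  then have "(1 + of_real (t / (1 - t)) * X) powr (- a) =
      of_real (1 / (1 - t)) powr (- a) * (1 - (1 - X) * of_real t) powr (- a)"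
    using t_unit by (simp only:) (intro powr_times_real_left; simp)
  moreover have "of_real (1 / (1 - t)) powr (- a) = of_real (1 - t) powr a"
    using t_unit powr_of_real_eq_exp[of "1 / (1 - t)" "- a"] powr_of_real_eq_exp[of "1 - t" a]
    by (simp add: ln_div)
  moreover have "(c - a - b - 1) + a = c - b - 1" by simp
  then have "of_real (1 - t) powr (c - a - b - 1) * of_real (1 - t) powr a =
      complex_of_real (1 - t) powr (c - b - 1)"
    by (simp only: powr_add[symmetric])
  then have "beta_weight b (c - a - b) t * of_real (1 - t) powr a = beta_weight b (c - b) t"
    by (simp only: beta_weight_def mult.assoc)
  ultimately show ?thesis
    by (simp add: Euler_integrand_def flip: mult.assoc)
qed

lemma hyp2F1_remainder_integrand_expand:
  assumes t_unit: "t \<in> {0<..<1}"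
  shows "hyp2F1_remainder_integrand N a b c X t = Euler_integrand a b c (1 - X) t
    - (\<Sum>k<N. (- a gchoose k) * X ^ k * beta_weight (b + of_nat k) (c - a - b - of_nat k) t)"
proof -
  define p where "p = of_real (t / (1 - t)) * X"
  have "beta_weight b (c - a - b) t * ((- a gchoose k) * p ^ k) =
      (- a gchoose k) * X ^ k * (beta_weight b (c - a - b) t * of_real (t / (1 - t)) ^ k)" for k
    unfolding p_def power_mult_distrib by (simp only: mult_ac)
  then have summand: "beta_weight b (c - a - b) t * ((- a gchoose k) * p ^ k) =
      (- a gchoose k) * X ^ k * beta_weight (b + of_nat k) (c - a - b - of_nat k) t" for k
    by (simp only: beta_weight_ratio_power[OF t_unit])
  show ?thesis
    unfolding hyp2F1_remainder_integrand_def binomial_remainder_def right_diff_distrib sum_distrib_left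
      Euler_integrand_eq_beta_weight[OF t_unit] by (simp only: summand flip: p_def)
qed

lemma has_bochner_integral_hyp2F1_remainder_integrand:
  assumes "0 < Re b" "Re b < Re c" "real N < Re (c - a - b)" "1 - X \<in> slit_plane"
  shows "has_bochner_integral unit_lebesgue (hyp2F1_remainder_integrand N a b c X)
    (Euler_integral a b c (1 - X)
        - (\<Sum>k<N. (- a gchoose k) * X ^ k * Beta (b + of_nat k) (c - a - b - of_nat k)))"
proof -
  have "has_bochner_integral unit_lebesgue (\<lambda>t. (- a gchoose k) * X ^ k
      * beta_weight (b + of_nat k) (c - a - b - of_nat k) t)
      ((- a gchoose k) * X ^ k * Beta (b + of_nat k) (c - a - b - of_nat k))" if "k < N" for k
    using assms that
    by (intro has_bochner_integral_mult_right)
      (auto simp: has_bochner_integral_iff integral_beta_weight intro!: integrable_beta_weight)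
  then have "has_bochner_integral unit_lebesgue (\<lambda>t. Euler_integrand a b c (1 - X) t
      - (\<Sum>k<N. (- a gchoose k) * X ^ k * beta_weight (b + of_nat k) (c - a - b - of_nat k) t))
    (Euler_integral a b c (1 - X)
        - (\<Sum>k<N. (- a gchoose k) * X ^ k * Beta (b + of_nat k) (c - a - b - of_nat k)))"
    using integrable_Euler_integrand[OF assms(1,2,4), of a]
    by (intro has_bochner_integral_diff has_bochner_integral_sum)
      (auto simp: has_bochner_integral_iff Euler_integral_def)
  then show ?thesis
    by (rule has_bochner_integral_cong[THEN iffD1, rotated -1])
      (auto simp: hyp2F1_remainder_integrand_expand)
qed

theorem hyp2F1_reg_expansion:
  assumes b_pos: "0 < Re b" and b_less_c: "Re b < Re c" and N_less: "real N < Re (c - a - b)"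
    and X_in: "1 - X \<in> slit_plane"
  shows "Gamma (c - a) * Gamma (c - b) * hyp2F1_reg a b c (1 - X) =
    (\<Sum>k<N. pochhammer a k * pochhammer b k / fact k * Gamma (c - a - b - of_nat k) * (- X) ^ k)
        + hyp2F1_remainder N a b c X"
proof -
  have Gamma: "rGamma b * Gamma b = 1" "rGamma (c - a) * Gamma (c - a) = 1"
    using b_pos N_less by (auto intro!: rGamma_mult_Gamma)
  have "Gamma (c - a) * rGamma b * ((- a gchoose k) * X ^ k * Beta (b + of_nat k) (c - a - b - of_nat k)) =
      pochhammer a k * pochhammer b k / fact k * Gamma (c - a - b - of_nat k) * (- X) ^ k" for k
  proof -
    have "rGamma (b + of_nat k) * Gamma (b + of_nat k) = 1"
      using b_pos by (intro rGamma_mult_Gamma) simp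
    then have "rGamma b * Gamma (b + of_nat k) = pochhammer b k"
      by (simp add: pochhammer_rGamma[of b k] mult.assoc)
    moreover have "Gamma (c - a) * rGamma b
        * ((- a gchoose k) * X ^ k * Beta (b + of_nat k) (c - a - b - of_nat k)) =
        ((- a gchoose k) * (- (- X)) ^ k) * (rGamma b * Gamma (b + of_nat k))
            * Gamma (c - a - b - of_nat k) * (rGamma (c - a) * Gamma (c - a))"
      by (simp add: Beta_altdef mult_ac)
    ultimately show ?thesis
      by (simp only: Gamma minus_gbinomial_power) simp
  qed
  then have "hyp2F1_remainder N a b c X = Gamma (c - a) * rGamma b * Euler_integral a b c (1 - X) -
      (\<Sum>k<N. pochhammer a k * pochhammer b k / fact k * Gamma (c - a - b - of_nat k) * (- X) ^ k)"
    using has_bochner_integral_hyp2F1_remainder_integrand[OF assms]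
    by (simp only: hyp2F1_remainder_def has_bochner_integral_iff right_diff_distrib sum_distrib_left)
  also have "Gamma (c - a) * rGamma b * Euler_integral a b c (1 - X) =
      (rGamma b * Gamma b) * (Gamma (c - a) * Gamma (c - b) * hyp2F1_reg a b c (1 - X))"
    using hyp2F1_reg_eq_Euler_integral[OF b_pos b_less_c X_in, of a] by (simp add: mult_ac)
  finally show ?thesis by (simp add: Gamma)
qed

lemma norm_hyp2F1_remainder_integrand_le:
  assumes t_unit: "t \<in> {0<..<1}" and "- real N < Re a" "Re X > 0"
  shows "norm (hyp2F1_remainder_integrand N a b c X t) \<le>
    norm (rGamma a) * Gamma (Re a + N) / fact N * norm X ^ N
        * beta_weight (Re b + N) (Re (c - a - b) - N) t"
proof -
  have "norm (hyp2F1_remainder_integrand N a b c X t) \<le> norm (beta_weight b (c - a - b) t) *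
      (norm (rGamma (- (- a))) * Gamma (N - Re (- a)) / fact N * norm (of_real (t / (1 - t)) * X) ^ N)"
    unfolding hyp2F1_remainder_integrand_def norm_mult[of "beta_weight _ _ _"] using assms
    by (intro mult_left_mono norm_binomial_remainder_le) auto
  also have "\<dots> = norm (rGamma a) * Gamma (Re a + N) / fact N * norm X ^ N *
      norm (beta_weight b (c - a - b) t * of_real (t / (1 - t)) ^ N)"
    unfolding norm_mult norm_power power_mult_distrib by (simp add: add.commute)
  also have "norm (beta_weight b (c - a - b) t * of_real (t / (1 - t)) ^ N) =
      beta_weight (Re b + N) (Re (c - a - b) - N) t"
    by (simp only: beta_weight_ratio_power[OF t_unit] norm_beta_weight[OF t_unit]) simp
  finally show ?thesis .
qed

theorem norm_hyp2F1_remainder_le: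
  assumes "- real N < Re a" "0 < Re b" "real N < Re (c - a - b)" "Re X > 0"
  shows "norm (hyp2F1_remainder N a b c X) \<le> norm (rGamma a * rGamma b) *
    (Gamma (Re a + N) * Gamma (Re b + N) * Gamma (Re (c - a - b) - N)) / fact N * norm X ^ N"
proof -
  define K where "K = norm (rGamma a) * Gamma (Re a + N) / fact N * norm X ^ N"
  let ?weight = "beta_weight (Re b + N) (Re (c - a - b) - N)"
  let ?Beta = "Beta (Re b + N) (Re (c - a - b) - N)"
  have weight: "integrable unit_lebesgue ?weight" "integral\<^sup>L unit_lebesgue ?weight = ?Beta"
    using assms has_bochner_integral_beta_weight_real[of "Re b + N" "Re (c - a - b) - N"]
    by (auto simp: has_bochner_integral_iff)
  have "norm (\<integral>t. hyp2F1_remainder_integrand N a b c X t \<partial>unit_lebesgue) \<le>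
      (\<integral>t. K * ?weight t \<partial>unit_lebesgue)"
  proof (rule order_trans[OF integral_norm_bound integral_mono'])
    fix t assume "t \<in> space unit_lebesgue"
    then show integrand_le: "norm (hyp2F1_remainder_integrand N a b c X t) \<le> K * ?weight t"
      using norm_hyp2F1_remainder_integrand_le[OF _ assms(1,4)] by (simp add: K_def)
    show "0 \<le> K * ?weight t" using norm_ge_zero integrand_le by (rule order_trans)
  qed (use weight in auto)
  then have integral: "norm (\<integral>t. hyp2F1_remainder_integrand N a b c X t \<partial>unit_lebesgue) \<le> K * ?Beta"
    by (simp only: Bochner_Integration.integral_mult_right_zero weight(2))
  have "Gamma (Re (c - a)) > 0" using assms by (intro Gamma_real_pos) simp
  moreover have "norm (Gamma (c - a)) \<le> Gamma (Re (c - a))"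
    using norm_Gamma_powr_le[of "c - a" 1] assms by simp
  ultimately have "norm (hyp2F1_remainder N a b c X) \<le> Gamma (Re (c - a)) * norm (rGamma b) * (K * ?Beta)"
    unfolding hyp2F1_remainder_def norm_mult using integral by (intro mult_mono mult_nonneg_nonneg) auto
  also have "?Beta = Gamma (Re b + N) * Gamma (Re (c - a - b) - N) / Gamma (Re (c - a))"
    by (simp add: Beta_def)
  finally show ?thesis
    using \<open>Gamma (Re (c - a)) > 0\<close> by (simp add: K_def norm_mult mult_ac)
qed

lemma (in finite_measure) sgn_integral:
  fixes f :: "'a \<Rightarrow> real"
  assumes int_f: "integrable M f" and sgn_f: "\<And>x. x \<in> space M \<Longrightarrow> sgn (f x) = s"
    and M_nonnull: "emeasure M (space M) \<noteq> 0"
  shows "sgn (\<integral>x. f x \<partial>M) = s"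
proof -
  obtain x where "x \<in> space M" using M_nonnull by fastforce
  then consider (zero) "s = 0" | (positive) "s = 1" | (negative) "s = - 1" using sgn_f[of x] by (auto simp: sgn_if split: if_splits)
  then show ?thesis
  proof cases
    case zero
    then have "(\<integral>x. f x \<partial>M) = (\<integral>x. 0 \<partial>M)"
      using sgn_f by (intro Bochner_Integration.integral_cong) (auto simp: sgn_0_0)
    then show ?thesis using zero by simp
  next
    case positive
    then have "(\<integral>x. 0 \<partial>M) < (\<integral>x. f x \<partial>M)"
      using sgn_f M_nonnull by (intro integral_less_AE_space int_f AE_I2) (auto simp: sgn_1_pos)
    then show ?thesis using positive by simp
  next
    case negative
    then have "(\<integral>x. f x \<partial>M) < (\<integral>x. 0 \<partial>M)"
      using sgn_f M_nonnull by (intro integral_less_AE_space int_f AE_I2) (auto simp: sgn_1_neg)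
    then show ?thesis using negative by simp
  qed
qed

lemma binomial_remainder_of_real:
  assumes "p \<ge> 0"
  shows "binomial_remainder N (of_real \<beta>) (of_real p) = complex_of_real (binomial_remainder N \<beta> p)"
proof -
  have "(1 + complex_of_real p) powr of_real \<beta> = of_real ((1 + p) powr \<beta>)"
    using assms powr_of_real[of "1 + p" \<beta>] by simp
  moreover have "(complex_of_real \<beta> gchoose k) = of_real (\<beta> gchoose k)" for k
    by (simp add: gbinomial_prod_rev)
  ultimately show ?thesis by (simp add: binomial_remainder_def)
qed

theorem hyp2F1_remainder_of_real:
  fixes a b c X :: real
  assumes b_bounds: "0 < b" "b < c" and N_less: "real N < c - a - b" and X_pos: "X > 0"
  obtains r where "hyp2F1_remainder N (of_real a) (of_real b) (of_real c) (of_real X) = of_real r"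
    "sgn r = sgn (- a gchoose N)"
proof -
  interpret finite_measure unit_lebesgue by (rule finite_measure_lebesgue_on) simp
  define f where "f t = beta_weight b (c - a - b) t * binomial_remainder N (- a) (t / (1 - t) * X)" for t
  have integrand_eq: "hyp2F1_remainder_integrand N (of_real a) (of_real b) (of_real c) (of_real X) t =
      of_real (f t)" if "t \<in> {0<..<1}" for t
    using that X_pos binomial_remainder_of_real[of "t / (1 - t) * X" N "- a"]
      beta_weight_of_real[OF that, of b "c - a - b"]
    by (simp add: f_def hyp2F1_remainder_integrand_def)
  have "1 - of_real X \<in> slit_plane" using X_pos by (simp add: slit_plane_iff)
  then have "integrable unit_lebesgue
      (hyp2F1_remainder_integrand N (of_real a) (of_real b) (of_real c) (of_real X))"
    using has_bochner_integral_hyp2F1_remainder_integrand[of "of_real b" "of_real c"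
        N "of_real a" "of_real X"] b_bounds N_less
    by (simp add: has_bochner_integral_iff)
  then have "integrable unit_lebesgue (\<lambda>t. complex_of_real (f t))"
    by (rule Bochner_Integration.integrable_cong[THEN iffD1, rotated -1]) (auto simp: integrand_eq)
  then have int_f: "integrable unit_lebesgue f" by (simp only: complex_of_real_integrable_eq)
  have "sgn (\<integral>t. f t \<partial>unit_lebesgue) = sgn (- a gchoose N)"
  proof (rule sgn_integral[OF int_f])
    fix t assume "t \<in> space unit_lebesgue"
    then have t_unit: "t \<in> {0<..<1}" by simp
    then have "sgn (binomial_remainder N (- a) (t / (1 - t) * X)) = sgn (- a gchoose N)"
      using X_pos by (intro sgn_binomial_remainder) simp
    then show "sgn (f t) = sgn (- a gchoose N)"
      using beta_weight_pos[OF t_unit, of b "c - a - b"] by (simp add: f_def sgn_mult)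
  qed (simp add: emeasure_restrict_space)
  moreover have "sgn (Gamma (c - a) * rGamma b) = 1"
    using b_bounds N_less by (simp add: sgn_mult rGamma_inverse_Gamma Gamma_real_pos)
  ultimately have "sgn (Gamma (c - a) * rGamma b * (\<integral>t. f t \<partial>unit_lebesgue)) = sgn (- a gchoose N)"
    by (simp only: sgn_mult[of "_ * _"])
  moreover have "(\<integral>t. hyp2F1_remainder_integrand N (of_real a) (of_real b) (of_real c) (of_real X) t
      \<partial>unit_lebesgue) = (\<integral>t. complex_of_real (f t) \<partial>unit_lebesgue)"
    by (intro Bochner_Integration.integral_cong) (auto simp: integrand_eq)
  then have "hyp2F1_remainder N (of_real a) (of_real b) (of_real c) (of_real X) =
      of_real (Gamma (c - a) * rGamma b * (\<integral>t. f t \<partial>unit_lebesgue))"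
    by (simp add: hyp2F1_remainder_def rGamma_complex_of_real Gamma_complex_of_real flip: of_real_diff)
  ultimately show ?thesis using that by blast
qed

subsection \<open>The Legendre function of the second kind\<close>

lemma rGamma_half_reflection:
  "rGamma (1/2 - z) * rGamma (1/2 + z) = cos (of_real pi * z) / of_real pi" for z :: complex
proof -
  have "rGamma (1/2 + z) * rGamma (1 - (1/2 + z)) = sin (of_real pi * (1/2 + z)) / of_real pi"
    by (rule rGamma_reflection_complex)
  also have "sin (of_real pi * (1/2 + z)) = cos (of_real pi * z)"
    by (simp add: ring_distribs sin_add)
  finally show ?thesis by (simp add: mult.commute)
qed

lemma rGamma_half_reflection_real: "rGamma (1/2 - x) * rGamma (1/2 + x) = cos (pi * x) / pi" for x :: real
proof -
  have "complex_of_real (rGamma (1/2 - x) * rGamma (1/2 + x)) = of_real (cos (pi * x) / pi)"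
    using rGamma_half_reflection[of "of_real x"] by (simp flip: rGamma_complex_of_real cos_of_real)
  then show ?thesis by (simp only: of_real_eq_iff)
qed

definition a_coeff_cos_quotient :: "nat \<Rightarrow> real \<Rightarrow> real" where
  "a_coeff_cos_quotient N x = Gamma (N + 1/2 - x) * Gamma (N + 1/2 + x) / (pi * 2 ^ N * fact N)"

lemma a_coeff_cos_quotient_pos: "\<bar>x\<bar> < N + 1/2 \<Longrightarrow> a_coeff_cos_quotient N x > 0"
  unfolding a_coeff_cos_quotient_def by (intro divide_pos_pos mult_pos_pos Gamma_real_pos) auto

lemma a_coeff_eq_cos:
  assumes "\<bar>x\<bar> < N + 1/2"
  shows "a_coeff N x = (- 1) ^ N * cos (pi * x) * a_coeff_cos_quotient N x"
proof -
  have poch: "pochhammer z N = rGamma z * Gamma (N + z)" if "z + N > 0" for z :: real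
    using pochhammer_rGamma[of z N] Gamma_real_pos[OF that] by (simp add: rGamma_inverse_Gamma add.commute)
  have "a_coeff N x =
      rGamma (1/2 - x) * rGamma (1/2 + x)
          * (Gamma (N + (1/2 - x)) * Gamma (N + (1/2 + x))) / ((- 2) ^ N * fact N)"
    unfolding a_coeff_pochhammer using assms by (subst (1 2) poch) (auto simp: mult_ac)
  also have "rGamma (1/2 - x) * rGamma (1/2 + x) = cos (pi * x) / pi"
    by (rule rGamma_half_reflection_real)
  also have "(- 2 :: real) ^ N = (- 1) ^ N * 2 ^ N" by (rule power_minus)
  finally show ?thesis
    by (cases "even N") (simp_all add: a_coeff_cos_quotient_def add_diff_eq add.assoc mult_ac)
qed

lemma abs_a_coeff_div_cos:
  assumes "\<bar>x\<bar> < N + 1/2" "cos (pi * x) \<noteq> 0"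
  shows "\<bar>a_coeff N x\<bar> / \<bar>cos (pi * x)\<bar> = a_coeff_cos_quotient N x"
  using assms a_coeff_cos_quotient_pos[OF assms(1)] by (simp add: a_coeff_eq_cos abs_mult power_abs)

lemma cos_pi_eq_0_iff: "cos (pi * x) = 0 \<longleftrightarrow> (\<exists>k :: int. odd k \<and> 2 * x = of_int k)"
  unfolding cos_zero_iff_int by (intro ex_cong1) (auto simp: field_simps)

lemma eventually_cos_pi_nonzero: "eventually (\<lambda>y. cos (pi * y) \<noteq> 0) (at x)" for x :: real
proof (cases "cos (pi * x) = 0")
  case False
  have "((\<lambda>y. cos (pi * y)) \<longlongrightarrow> cos (pi * x)) (at x)" by (intro tendsto_intros)
  then show ?thesis using False by (rule tendsto_imp_eventually_ne)
next
  case True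
  have "eventually (\<lambda>y. y \<in> {x - 1<..<x + 1} - {x}) (at x)"
    by (intro eventually_at_in_open) auto
  then show ?thesis
  proof eventually_elim
    case (elim y)
    have "pi * (y - x) < pi" "- pi < pi * (y - x)" "pi * (y - x) \<noteq> 0"
      using elim mult_strict_left_mono[of "y - x" 1 pi] mult_strict_left_mono[of "- 1" "y - x" pi] by auto
    then have "sin (pi * (y - x)) \<noteq> 0" using sin_eq_0_pi by blast
    moreover have "sin (pi * x) \<noteq> 0" using True sin_cos_squared_add[of "pi * x"] by auto
    moreover have "cos (pi * y) = cos (pi * x + pi * (y - x))" by (simp add: algebra_simps)
    ultimately show ?case using True by (simp only: cos_add) simp
  qed
qed

lemma limiting_a_coeff_cos_quotient:
  fixes x :: real
  assumes x_less: "\<bar>x\<bar> < N + 1/2"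
  shows "(if \<exists>k :: int. odd k \<and> 2 * x = of_int k
       then Lim (at x) (\<lambda>x. \<bar>a_coeff N x\<bar> / \<bar>cos (pi * x)\<bar>)
       else \<bar>a_coeff N x\<bar> / \<bar>cos (pi * x)\<bar>) = a_coeff_cos_quotient N x"
proof -
  have "(a_coeff_cos_quotient N \<longlongrightarrow> a_coeff_cos_quotient N x) (at x)"
    unfolding a_coeff_cos_quotient_def [abs_def] using x_less
    by (intro tendsto_intros) (auto elim!: nonpos_Ints_cases)
  moreover have "eventually (\<lambda>y. y \<in> {- (N + 1/2)<..<N + 1/2}) (at x)"
    using x_less by (intro eventually_at_in_open') (auto simp: abs_less_iff)
  with eventually_cos_pi_nonzero have "eventually (\<lambda>y. a_coeff_cos_quotient N y =
      \<bar>a_coeff N y\<bar> / \<bar>cos (pi * y)\<bar>) (at x)"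
    by eventually_elim (auto simp: abs_less_iff intro!: abs_a_coeff_div_cos[symmetric])
  ultimately have "((\<lambda>y. \<bar>a_coeff N y\<bar> / \<bar>cos (pi * y)\<bar>) \<longlongrightarrow> a_coeff_cos_quotient N x) (at x)"
    by (rule Lim_transform_eventually)
  then have "Lim (at x) (\<lambda>x. \<bar>a_coeff N x\<bar> / \<bar>cos (pi * x)\<bar>) = a_coeff_cos_quotient N x"
    by (intro tendsto_Lim) auto
  then show ?thesis using abs_a_coeff_div_cos[OF x_less] by (simp flip: cos_pi_eq_0_iff)
qed

text \<open>Both choices of the sign give the same sum; \<open>Re m \<ge> 0\<close> makes the integral converge.\<close>
definition legendre_remainder :: "nat \<Rightarrow> complex \<Rightarrow> complex \<Rightarrow> complex \<Rightarrow> complex" where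
  "legendre_remainder N \<mu> \<nu> X =
     (let m = (if Re \<mu> \<ge> 0 then \<mu> else - \<mu>) in hyp2F1_remainder N (1/2 - m) (1/2 + m) (\<nu> + 3/2) X)"

lemma legendre_remainder_cases:
  obtains m where "m = \<mu> \<or> m = - \<mu>" "Re m \<ge> 0" "\<bar>Re m\<bar> = \<bar>Re \<mu>\<bar>"
    "legendre_remainder N \<mu> \<nu> X = hyp2F1_remainder N (1/2 - m) (1/2 + m) (\<nu> + 3/2) X"
  by (rule that[of "if Re \<mu> \<ge> 0 then \<mu> else - \<mu>"]) (auto simp: legendre_remainder_def Let_def)

lemma a_coeff_minus [simp]: "a_coeff n (- x) = a_coeff n x"
  by (simp add: a_coeff_def)

lemma legendre_hyp2F1_expansion:
  assumes \<mu>_less: "\<bar>Re \<mu>\<bar> < real N + 1/2" and \<nu>_greater: "Re \<nu> > real N - 1/2" and X_pos: "Re X > 0"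
  shows "Gamma (\<nu> - \<mu> + 1) * Gamma (\<nu> + \<mu> + 1) * hyp2F1_reg (1/2 - \<mu>) (1/2 + \<mu>) (\<nu> + 3/2) (1 - X) =
    (\<Sum>n<N. a_coeff n \<mu> * Gamma (\<nu> - of_nat n + 1/2) * (2 * X) ^ n) + legendre_remainder N \<mu> \<nu> X"
proof -
  obtain m where m_facts: "m = \<mu> \<or> m = - \<mu>" "Re m \<ge> 0" "\<bar>Re m\<bar> = \<bar>Re \<mu>\<bar>"
    "legendre_remainder N \<mu> \<nu> X = hyp2F1_remainder N (1/2 - m) (1/2 + m) (\<nu> + 3/2) X"
    by (rule legendre_remainder_cases)
  have params: "\<nu> + 3/2 - (1/2 - m) = \<nu> + m + 1" "\<nu> + 3/2 - (1/2 + m) = \<nu> - m + 1"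
    "\<nu> + m + 1 - (1/2 + m) - of_nat n = \<nu> - of_nat n + 1/2" for n
    by (simp_all add: field_simps)
  have summand: "pochhammer (1/2 - m) n * pochhammer (1/2 + m) n / fact n * Gamma (\<nu> - of_nat n + 1/2)
      * (- X) ^ n =
      a_coeff n m * Gamma (\<nu> - of_nat n + 1/2) * (2 * X) ^ n" for n
  proof -
    have "(2 * X) ^ n = (- 2) ^ n * (- X) ^ n"
      using power_mult_distrib[of "- 2" "- X" n] by simp
    then show ?thesis by (simp add: a_coeff_pochhammer)
  qed
  have "Gamma (\<nu> + m + 1) * Gamma (\<nu> - m + 1) * hyp2F1_reg (1/2 - m) (1/2 + m) (\<nu> + 3/2) (1 - X) =
      (\<Sum>n<N. a_coeff n m * Gamma (\<nu> - of_nat n + 1/2) * (2 * X) ^ n) + legendre_remainder N \<mu> \<nu> X"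
    using hyp2F1_reg_expansion[of "1/2 + m" "\<nu> + 3/2" N "1/2 - m" X] m_facts(2,3) \<mu>_less \<nu>_greater X_pos
    unfolding params summand m_facts(4) by (auto simp: slit_plane_iff complex_nonpos_Reals_iff)
  moreover have "Gamma (\<nu> + m + 1) * Gamma (\<nu> - m + 1) = Gamma (\<nu> - \<mu> + 1) * Gamma (\<nu> + \<mu> + 1)"
    "hyp2F1_reg (1/2 - m) (1/2 + m) = hyp2F1_reg (1/2 - \<mu>) (1/2 + \<mu>)" "a_coeff n m = a_coeff n \<mu>" for n
    using m_facts(1) by (auto simp: fun_eq_iff hyp2F1_reg_commute[of "1/2 + \<mu>"])
  ultimately show ?thesis by simp
qed

lemma norm_legendre_remainder_le:
  assumes \<mu>_less: "\<bar>Re \<mu>\<bar> < real N + 1/2" and \<nu>_greater: "Re \<nu> > real N - 1/2" and X_pos: "Re X > 0"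
  shows "norm (legendre_remainder N \<mu> \<nu> X) \<le>
    norm (cos (of_real pi * \<mu>)) * a_coeff_cos_quotient N (Re \<mu>) * Gamma (Re \<nu> - N + 1/2) * norm (2 * X) ^ N"
proof -
  obtain m where m_facts: "m = \<mu> \<or> m = - \<mu>" "Re m \<ge> 0" "\<bar>Re m\<bar> = \<bar>Re \<mu>\<bar>"
    "legendre_remainder N \<mu> \<nu> X = hyp2F1_remainder N (1/2 - m) (1/2 + m) (\<nu> + 3/2) X"
    by (rule legendre_remainder_cases)
  have "norm (legendre_remainder N \<mu> \<nu> X) \<le> norm (cos (of_real pi * m) / of_real pi) *
      (Gamma (N + 1/2 - Re m) * Gamma (N + 1/2 + Re m) * Gamma (Re \<nu> - N + 1/2)) / fact N * norm X ^ N"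
    using norm_hyp2F1_remainder_le[of N "1/2 - m" "1/2 + m" "\<nu> + 3/2" X] m_facts(2,3) \<mu>_less \<nu>_greater X_pos
    unfolding m_facts(4) rGamma_half_reflection by (simp add: algebra_simps)
  also have "\<dots> =
      norm (cos (of_real pi * m)) * a_coeff_cos_quotient N (Re m) * Gamma (Re \<nu> - N + 1/2)
          * norm (2 * X) ^ N"
    by (simp add: a_coeff_cos_quotient_def norm_mult norm_divide power_mult_distrib)
  also have "\<dots> =
      norm (cos (of_real pi * \<mu>)) * a_coeff_cos_quotient N (Re \<mu>) * Gamma (Re \<nu> - N + 1/2)
          * norm (2 * X) ^ N"
    using m_facts(1) by (auto simp: a_coeff_cos_quotient_def mult_ac)
  finally show ?thesis .
qed

lemma legendre_remainder_of_real:
  fixes \<mu> \<nu> X :: real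
  assumes \<mu>_less: "\<bar>\<mu>\<bar> < real N + 1/2" and \<nu>_greater: "\<nu> > real N - 1/2" and X_pos: "X > 0"
  obtains r where "legendre_remainder N (of_real \<mu>) (of_real \<nu>) (of_real X) = of_real r"
    "sgn r = sgn (a_coeff N \<mu>)"
proof -
  define m where "m = \<bar>\<mu>\<bar>"
  have m_bounds: "m \<ge> 0" "m < real N + 1/2" using \<mu>_less by (auto simp: m_def)
  have "legendre_remainder N (of_real \<mu>) (of_real \<nu>) (of_real X) =
      hyp2F1_remainder N (of_real (1/2 - m)) (of_real (1/2 + m)) (of_real (\<nu> + 3/2)) (of_real X)"
    by (simp add: legendre_remainder_def Let_def m_def)
  moreover obtain r where
      "hyp2F1_remainder N (of_real (1/2 - m)) (of_real (1/2 + m)) (of_real (\<nu> + 3/2)) (of_real X) = of_real r"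
      "sgn r = sgn (- (1/2 - m) gchoose N)"
    by (rule hyp2F1_remainder_of_real[of "1/2 + m" "\<nu> + 3/2" N "1/2 - m" X])
      (use m_bounds \<nu>_greater X_pos in auto)
  moreover have "sgn (- (1/2 - m) gchoose N) = sgn (a_coeff N m)"
  proof -
    have "a_coeff N m = (- (1/2 - m) gchoose N) * (pochhammer (1/2 + m) N / 2 ^ N)"
      by (cases "even N") (simp_all add: a_coeff_pochhammer gbinomial_pochhammer power_minus[of 2])
    moreover have "pochhammer (1/2 + m) N > 0" using m_bounds by (intro pochhammer_pos) simp
    ultimately show ?thesis by (simp add: sgn_mult)
  qed
  moreover have "a_coeff N m = a_coeff N \<mu>" by (cases "\<mu> \<ge> 0") (simp_all add: m_def)
  ultimately show ?thesis using that by simp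
qed

lemma legendre_remainder_enveloping:
  assumes \<mu>_less: "\<bar>Re \<mu>\<bar> < real N + 1/2" and \<nu>_greater: "Re \<nu> > real N - 1/2" and X_pos: "Re X > 0"
    and real: "X \<in> \<real>" "\<mu> \<in> \<real>" "\<nu> \<in> \<real>"
  defines "T \<equiv> a_coeff N \<mu> * Gamma (\<nu> - of_nat N + 1/2) * (2 * X) ^ N"
  shows "legendre_remainder N \<mu> \<nu> X \<in> \<real>"
    and "norm (legendre_remainder N \<mu> \<nu> X) \<le> norm T"
    and "sgn (Re (legendre_remainder N \<mu> \<nu> X)) = sgn (Re T)"
proof -
  obtain m n x where reals: "\<mu> = of_real m" "\<nu> = of_real n" "X = of_real x"
    using real by (auto elim!: Reals_cases)
  obtain r where r_eq: "legendre_remainder N \<mu> \<nu> X = of_real r" "sgn r = sgn (a_coeff N m)"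
    using \<mu>_less \<nu>_greater X_pos unfolding reals by (auto elim: legendre_remainder_of_real[of m N n x])
  have pos: "Gamma (n - N + 1/2) > 0" "x > 0" "a_coeff_cos_quotient N m > 0"
    using \<mu>_less \<nu>_greater X_pos by (auto simp: reals Gamma_real_pos a_coeff_cos_quotient_pos)
  have "a_coeff N \<mu> = of_real (a_coeff N m)" by (simp add: a_coeff_def reals)
  then have T_eq: "T = of_real (a_coeff N m * Gamma (n - N + 1/2) * (2 * x) ^ N)"
    by (simp add: T_def reals flip: Gamma_complex_of_real)
  have "cos (of_real pi * \<mu>) = of_real (cos (pi * m))"
    by (simp add: reals flip: cos_of_real)
  moreover have "\<bar>m\<bar> < N + 1/2" using \<mu>_less by (simp add: reals)
  ultimately have "norm T =
      norm (cos (of_real pi * \<mu>)) * a_coeff_cos_quotient N (Re \<mu>) * Gamma (Re \<nu> - N + 1/2)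
          * norm (2 * X) ^ N"
    unfolding T_eq norm_of_real using pos by (simp add: reals a_coeff_eq_cos abs_mult power_abs norm_mult)
  then show "norm (legendre_remainder N \<mu> \<nu> X) \<le> norm T"
    using norm_legendre_remainder_le[OF \<mu>_less \<nu>_greater X_pos] by simp
  show "legendre_remainder N \<mu> \<nu> X \<in> \<real>" by (simp add: r_eq)
  show "sgn (Re (legendre_remainder N \<mu> \<nu> X)) = sgn (Re T)"
    using r_eq pos by (simp add: T_eq sgn_mult)
qed

lemma legendre_Q_expansion:
  assumes \<xi>_in: "\<xi> \<in> D1" and \<mu>_less: "\<bar>Re \<mu>\<bar> < real N + 1 / 2" and \<nu>_greater: "Re \<nu> > real N - 1 / 2"
  shows "exp (- (of_real pi * \<i> * \<mu>)) * legendre_Q \<nu> \<mu> (cosh \<xi>) =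
      csqrt (of_real pi / (2 * sinh \<xi>)) * exp (- ((\<nu> + 1 / 2) * \<xi>)) / Gamma (\<nu> - \<mu> + 1) *
      ((\<Sum>n<N. a_coeff n \<mu> * Gamma (\<nu> - of_nat n + 1 / 2) * (exp \<xi> / sinh \<xi>) ^ n)
        + legendre_remainder N \<mu> \<nu> (exp \<xi> / (2 * sinh \<xi>)))"
proof -
  have "Re \<xi> > 0" using \<xi>_in by (simp add: D1_def)
  note X_pos = Re_exp_div_sinh_pos[OF this]
  have params: "\<bar>Re \<mu>\<bar> < Re \<nu> + 1" using \<mu>_less \<nu>_greater by linarith
  then have "Re (\<nu> - \<mu> + 1) > 0" by simp
  then have "Gamma (\<nu> - \<mu> + 1) \<noteq> 0"
    using rGamma_mult_Gamma[of "\<nu> - \<mu> + 1"] by force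
  then have "legendre_prefactor \<nu> \<xi> * Gamma (\<nu> + \<mu> + 1) * F =
      legendre_prefactor \<nu> \<xi> / Gamma (\<nu> - \<mu> + 1) * (Gamma (\<nu> - \<mu> + 1) * Gamma (\<nu> + \<mu> + 1) * F)" for F
    by simp
  then show ?thesis
    unfolding legendre_Q_cosh[OF \<xi>_in params]
    by (simp only: legendre_hyp2F1_expansion[OF \<mu>_less \<nu>_greater X_pos]) (simp add: legendre_prefactor_def)
qed

theorem theorem3p2:
  fixes \<xi> \<mu> \<nu> :: complex and N :: nat
  assumes "\<xi> \<in> D1"
    and "\<bar>Re \<mu>\<bar> < real N + 1 / 2"
    and "Re \<nu> > real N - 1 / 2"
  shows "\<exists>R :: complex.
    exp (- (of_real pi * \<i> * \<mu>)) * legendre_Q \<nu> \<mu> (cosh \<xi>) =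
      csqrt (of_real pi / (2 * sinh \<xi>)) * exp (- ((\<nu> + 1 / 2) * \<xi>)) / Gamma (\<nu> - \<mu> + 1) *
      ((\<Sum>n<N. a_coeff n \<mu> * Gamma (\<nu> - of_nat n + 1 / 2) * (exp \<xi> / sinh \<xi>) ^ n) + R) \<and>
    norm R \<le>
      norm (cos (of_real pi * \<mu>)) *
      (if \<exists>k :: int. odd k \<and> 2 * Re \<mu> = of_int k
       then Lim (at (Re \<mu>)) (\<lambda>x. \<bar>a_coeff N x\<bar> / \<bar>cos (pi * x)\<bar>)
       else \<bar>a_coeff N (Re \<mu>)\<bar> / \<bar>cos (pi * Re \<mu>)\<bar>) *
      Gamma (Re \<nu> - real N + 1 / 2) * norm (exp \<xi> / sinh \<xi>) ^ N \<and>
    (\<xi> \<in> \<real> \<and> Re \<xi> > 0 \<and> \<mu> \<in> \<real> \<and> \<nu> \<in> \<real> \<longrightarrow>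
      (let T = a_coeff N \<mu> * Gamma (\<nu> - of_nat N + 1 / 2) * (exp \<xi> / sinh \<xi>) ^ N
       in R \<in> \<real> \<and> norm R \<le> norm T \<and> sgn (Re R) = sgn (Re T)))"
proof -
  define X where "X = exp \<xi> / (2 * sinh \<xi>)"
  define R where "R = legendre_remainder N \<mu> \<nu> X"
  have X_facts: "Re X > 0" "exp \<xi> / sinh \<xi> = 2 * X"
    using Re_exp_div_sinh_pos[of \<xi>] assms(1) by (simp_all add: X_def D1_def)
  show ?thesis
    unfolding limiting_a_coeff_cos_quotient[OF assms(2)] Let_def
  proof (intro exI[of _ R] conjI impI)
    show "exp (- (of_real pi * \<i> * \<mu>)) * legendre_Q \<nu> \<mu> (cosh \<xi>) =
      csqrt (of_real pi / (2 * sinh \<xi>)) * exp (- ((\<nu> + 1 / 2) * \<xi>)) / Gamma (\<nu> - \<mu> + 1) *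
      ((\<Sum>n<N. a_coeff n \<mu> * Gamma (\<nu> - of_nat n + 1 / 2) * (exp \<xi> / sinh \<xi>) ^ n) + R)"
      unfolding R_def X_def using assms by (rule legendre_Q_expansion)
    show "norm R \<le> norm (cos (of_real pi * \<mu>)) * a_coeff_cos_quotient N (Re \<mu>) * Gamma (Re \<nu> - real N + 1 / 2) *
        norm (exp \<xi> / sinh \<xi>) ^ N"
      unfolding R_def X_facts(2) using assms(2,3) X_facts(1) by (rule norm_legendre_remainder_le)
    let ?T = "a_coeff N \<mu> * Gamma (\<nu> - of_nat N + 1 / 2) * (exp \<xi> / sinh \<xi>) ^ N"
    assume "\<xi> \<in> \<real> \<and> Re \<xi> > 0 \<and> \<mu> \<in> \<real> \<and> \<nu> \<in> \<real>"
    then have "X \<in> \<real>" "\<mu> \<in> \<real>" "\<nu> \<in> \<real>"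
      by (auto simp: X_def sinh_field_def)
    with assms(2,3) X_facts(1) show "R \<in> \<real>" "norm R \<le> norm ?T" "sgn (Re R) = sgn (Re ?T)"
      unfolding R_def X_facts(2) by (rule legendre_remainder_enveloping)+
  qed
qed

end
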